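(* Let $\alpha\in(0,\infty)$, let $g\colon\mathbb{R}\to[0,1]$ be measurable and symmetric with $\lim_{|x|\to\infty} g(x)/|x|^{-\alpha}=1$, and for $n\in\mathbb{N}$ let $(\mathcal{P}_n,E_n)$ be the soft random geometric graph on $[-n,n]$ with connection function $g$. Let $e_n^*=\max_{\{x,y\}\in E_n}|x-y|$ be the length of its longest edge, and let $U$ be a random variable uniformly distributed on $(0,1)$. Then, with $\xrightarrow{d}$ denoting convergence in distribution as $n\to\infty$: (I) If $\alpha>2$, then $$\exp\left(\frac{2n}{1-\alpha}(e_n^* )^{1-\alpha}\right)\xrightarrow{d}U.$$ (II) If $\alpha=2$, then $$h\left(\frac{e_n^*}{n}\right)^{-1}\xrightarrow{d}U,$$ where $h(x)=\frac{x}{2}\exp\left(\frac{2-x}{x}\right)$ for $x\in(0,2]$. (III) If $1<\alpha<2$, then $$\exp\left(-(2n)^{\alpha-2}\,2^{-1}(2-\alpha)^{-2}\left((e_n^* )^{2-\alpha}-(2n)^{2-\alpha}\right)^2\right)\xrightarrow{d}U.$$ (IV) If $\alpha=1$, then $$\exp\left(-n\left(\ln\frac{e_n^*}{2n}\right)^2\right)\xrightarrow{d}U.$$ (V) If $\alpha<1$, then $$\exp\left(-(2n)^{\alpha}\,2^{-1}(1-\alpha)^{-2}\left((e_n^* )^{1-\alpha}-(2n)^{1-\alpha}\right)^2\right)\xrightarrow{d}U.$$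
   Context: Soft random geometric graph: Let $\mathcal{P}$ be a homogeneous Poisson point process on $\mathbb{R}$ with unit intensity, $B_n=[-n,n]$, and $\mathcal{P}_n=\mathcal{P}\cap B_n$, viewed as a random subset of $B_n$. Given $\mathcal{P}_n$, each unordered pair of distinct points $x,y\in\mathcal{P}_n$ is connected by an edge $\{x,y\}$ with probability $g(x-y)$, independently of all other pairs; $E_n$ is the set of all edges obtained. The function $g$ is called the connection function; symmetric means $g(x)=g(-x)$ for all $x\in\mathbb{R}$. If $E_n=\emptyset$, set $e_n^*=0$ and give the transformed quantities in (I), (II) and (IV) the value $0$. *)

theory Defs
  imports "HOL-Probability.Probability"
begin

text \<open>The measurable space of locally finite subsets of the real line, with the \<open>\<sigma>\<close>-algebra
  generated by the counting maps of bounded Borel sets.\<close>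

definition point_configs :: "real set measure" where
  "point_configs =
     (let \<Omega> = {p. \<forall>K. bounded K \<longrightarrow> finite (p \<inter> K)}
      in sigma \<Omega> {{p \<in> \<Omega>. card (p \<inter> A) = k} | A k. A \<in> sets borel \<and> bounded A})"

text \<open>The Poisson probabilities are written out because \<open>poisson_pmf\<close> requires a positive rate,
  whereas \<open>A\<close> may be a null set here.\<close>

definition homogeneous_poisson_process :: "'a measure \<Rightarrow> real \<Rightarrow> ('a \<Rightarrow> real set) \<Rightarrow> bool" where
  "homogeneous_poisson_process M r P \<longleftrightarrow>
     P \<in> M \<rightarrow>\<^sub>M point_configs \<and>
     (\<forall>A k. A \<in> sets borel \<and> bounded A \<longrightarrow>
        measure M {\<omega> \<in> space M. card (P \<omega> \<inter> A) = k} =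
          (r * measure lborel A) ^ k / fact k * exp (- (r * measure lborel A))) \<and>
     (\<forall>(A :: nat \<Rightarrow> real set) m.
        (\<forall>i<m. A i \<in> sets borel \<and> bounded (A i)) \<and> disjoint_family_on A {..<m} \<longrightarrow>
        prob_space.indep_vars M (\<lambda>_. count_space UNIV) (\<lambda>i \<omega>. card (P \<omega> \<inter> A i)) {..<m})"

definition unordered_pairs :: "real set \<Rightarrow> real set set" where
  "unordered_pairs p = {{x, y} | x y. x \<in> p \<and> y \<in> p \<and> x \<noteq> y}"

text \<open>The measurable space of finite edge sets. An edge \<open>{x, y}\<close> counts for \<open>C\<close> if it belongs to
  \<open>C\<close> in at least one of its two orientations.\<close>

definition edge_configs :: "real set set measure" where
  "edge_configs =
     (let \<Omega> = {F. finite F \<and> F \<subseteq> unordered_pairs UNIV}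
      in sigma \<Omega> {{F \<in> \<Omega>. card {e \<in> F. \<exists>x y. e = {x, y} \<and> (x, y) \<in> C} = k} | C k.
                   C \<in> sets (borel :: (real \<times> real) measure)})"

text \<open>The conditional law of the edge set given the finite point set \<open>p\<close>: independent Bernoulli
  trials over the unordered pairs. The pair \<open>{x, y}\<close> is oriented by size before \<open>g\<close> is applied
  to the difference, which is immaterial for symmetric \<open>g\<close>.\<close>

definition edge_law :: "(real \<Rightarrow> real) \<Rightarrow> real set \<Rightarrow> real set set pmf" where
  "edge_law g p =
     map_pmf (\<lambda>b. {e \<in> unordered_pairs p. b e})
       (Pi_pmf (unordered_pairs p) False (\<lambda>e. bernoulli_pmf (g (Max e - Min e))))"

text \<open>\<open>Q\<close> is the random finite vertex set and \<open>E\<close> the random edge set; the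
  \<open>\<sigma>\<close>-algebra conditioned on is the one generated by \<open>Q\<close>.\<close>

definition soft_random_graph ::
  "'a measure \<Rightarrow> (real \<Rightarrow> real) \<Rightarrow> ('a \<Rightarrow> real set) \<Rightarrow> ('a \<Rightarrow> real set set) \<Rightarrow> bool" where
  "soft_random_graph M g Q E \<longleftrightarrow>
     Q \<in> M \<rightarrow>\<^sub>M point_configs \<and> E \<in> M \<rightarrow>\<^sub>M edge_configs \<and>
     (\<forall>\<omega>\<in>space M. finite (Q \<omega>) \<and> E \<omega> \<subseteq> unordered_pairs (Q \<omega>)) \<and>
     (\<forall>S\<in>sets edge_configs. AE \<omega> in M.
        real_cond_exp M (vimage_algebra (space M) Q point_configs)
          (indicator {\<omega> \<in> space M. E \<omega> \<in> S}) \<omega> =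
        measure_pmf.prob (edge_law g (Q \<omega>)) S)"

definition longest_edge :: "real set set \<Rightarrow> real" where
  "longest_edge F = (if F = {} then 0 else Max {\<bar>x - y\<bar> | x y. {x, y} \<in> F})"

definition h :: "real \<Rightarrow> real" where
  "h x = x / 2 * exp ((2 - x) / x)"

end

theory Submission
  imports Defs "HOL-Real_Asymp.Real_Asymp"
begin

text \<open>
  Fix a threshold \<open>r\<close>. Given the vertices, the event that no edge is longer than \<open>r\<close> has probability
  \<open>\<Prod> (1 - g (y - x))\<close>, the product extending over all pairs of vertices \<open>x < y\<close> with \<open>y - x > r\<close>. When
  \<open>r\<close> is large, all these values of \<open>g\<close> are small and close to \<open>(y - x) powr (- \<alpha>)\<close>, so the
  product is nearly \<open>exp (- W)\<close> where \<open>W\<close> is the sum of \<open>(y - x) powr (- \<alpha>)\<close> over these pairs. The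
  mean of \<open>W\<close> is the integral of \<open>(2 * n - t) * t powr (- \<alpha>)\<close> over \<open>t\<close> from \<open>r\<close> to \<open>2 * n\<close>. Its variance
  is at most a constant times this mean times the maximal expected number of long edges at one vertex.
  The latter tends to 0 for every threshold sequence at which the mean converges to some \<open>\<Lambda> > 0\<close>; then
  \<open>W\<close> concentrates at \<open>\<Lambda>\<close> and the probability of having no long edge tends to \<open>exp (- \<Lambda>)\<close>
  (\<open>prob_no_long_edge_tendsto\<close>).

  The moments of \<open>W\<close> reduce to those of finitely many independent variables: the function
  \<open>t powr (- \<alpha>)\<close> is monotone, so \<open>W\<close> lies between two quadratic forms in the numbers of points in unit
  cells, which are independent Poisson variables with mean 1 (\<open>quadratic_form_moments\<close>). Unit cells
  shift the threshold by a bounded amount only. This does not affect the limit because the threshold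
  itself tends to infinity and, for \<open>\<alpha> < 2\<close>, so does its distance to the maximal possible length
  \<open>2 * n\<close>.

  It remains to compute, for \<open>0 < u < 1\<close>, the thresholds \<open>r n\<close> at which the transformation takes the
  value \<open>u\<close>, and to check that the mean of \<open>W\<close> there converges to \<open>- ln u\<close>. There are three regimes.
  For \<open>\<alpha> > 2\<close> the thresholds are \<open>o(n)\<close> and the mean is asymptotically
  \<open>2 * n * r powr (1 - \<alpha>) / (\<alpha> - 1)\<close>. For \<open>\<alpha> = 2\<close> they are proportional to \<open>n\<close> and the mean tends to
  \<open>ln (h (r / n))\<close>. For \<open>\<alpha> < 2\<close> the gap \<open>2 * n - r\<close> is of order \<open>n powr (\<alpha> / 2)\<close> and the mean is
  asymptotically \<open>(2 * n) powr (- \<alpha>) * (2 * n - r)\<^sup>2 / 2\<close>; the transformations for \<open>1 < \<alpha> < 2\<close>,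
  \<open>\<alpha> = 1\<close> and \<open>\<alpha> < 1\<close> all express this same quantity.
\<close>

section \<open>Unit cells and quadratic forms in their counts\<close>

lemma poisson_one_moments:
  fixes X :: "'a \<Rightarrow> nat"
  assumes "prob_space M" and X: "X \<in> M \<rightarrow>\<^sub>M count_space UNIV"
    and pX: "\<And>k. measure M {\<omega> \<in> space M. X \<omega> = k} = 1 / fact k * exp (-1)"
  shows "integrable M (\<lambda>\<omega>. real (X \<omega>))" "(\<integral>\<omega>. real (X \<omega>) \<partial>M) = 1"
    "integrable M (\<lambda>\<omega>. real (X \<omega>) ^ 2)" "(\<integral>\<omega>. real (X \<omega>) ^ 2 \<partial>M) = 2"
proof -
  interpret prob_space M by fact
  note X[measurable]
  have distr: "distr M (count_space UNIV) X = measure_pmf (poisson_pmf 1)"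
  proof (rule measure_eqI_countable[where A = UNIV])
    fix k :: nat
    have "emeasure (distr M (count_space UNIV) X) {k} = emeasure M (X -` {k} \<inter> space M)"
      by (rule emeasure_distr) auto
    also have "X -` {k} \<inter> space M = {\<omega> \<in> space M. X \<omega> = k}" by auto
    also have "emeasure M \<dots> = ennreal (1 / fact k * exp (-1))"
      unfolding emeasure_eq_measure pX ..
    finally show "emeasure (distr M (count_space UNIV) X) {k} = emeasure (measure_pmf (poisson_pmf 1)) {k}"
      by (simp add: emeasure_pmf_single)
  qed auto
  have moment: "has_bochner_integral M (\<lambda>\<omega>. f (X \<omega>)) s"
    if f: "\<And>k. 0 \<le> f k" and s: "(\<lambda>k. 1 / fact k * f k) sums (s * exp 1)" for f :: "nat \<Rightarrow> real" and s
  proof -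
    have s': "(\<lambda>k. 1 / fact k * exp (-1) * f k) sums s"
      using sums_mult[OF s, of "exp (-1)"] by (simp add: mult_ac exp_minus)
    have "(\<integral>\<^sup>+\<omega>. ennreal (f (X \<omega>)) \<partial>M) = (\<integral>\<^sup>+k. ennreal (f k) \<partial>measure_pmf (poisson_pmf 1))"
      unfolding distr[symmetric] by (rule nn_integral_distr[symmetric]) auto
    also have "\<dots> = (\<integral>\<^sup>+k. ennreal (1 / fact k * exp (-1) * f k) \<partial>count_space UNIV)"
      by (subst nn_integral_measure_pmf)
        (intro nn_integral_cong, simp add: ennreal_mult[symmetric] f)
    also have "\<dots> = (\<Sum>k. ennreal (1 / fact k * exp (-1) * f k))"
      by (rule nn_integral_count_space_nat)
    also have "\<dots> = ennreal s"
      using s' by (intro suminf_ennreal_eq) (auto simp: f)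
    finally have eq: "(\<integral>\<^sup>+\<omega>. ennreal (f (X \<omega>)) \<partial>M) = ennreal s" .
    have "0 \<le> s" using s' by (rule sums_le[OF _ sums_zero, rotated]) (auto simp: f)
    then show ?thesis
      using eq by (intro has_bochner_integral_nn_integral) (auto simp: f)
  qed
  have exp1: "(\<lambda>k. 1 / fact k :: real) sums exp 1"
    using exp_converges[of "1::real"] by (simp add: divide_inverse)
  have s1: "(\<lambda>k. 1 / fact k * real k) sums (1 * exp 1)"
  proof (rule sums_Suc_imp)
    have "(\<lambda>k. 1 / fact (Suc k) * real (Suc k)) = (\<lambda>k. 1 / fact k)"
      by (simp add: fun_eq_iff del: of_nat_Suc)
    then show "(\<lambda>k. 1 / fact (Suc k) * real (Suc k)) sums (1 * exp 1)"
      using exp1 by simp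
  qed simp
  have s2: "(\<lambda>k. 1 / fact k * real k ^ 2) sums (2 * exp 1)"
  proof -
    have "1 / fact (Suc k) * real (Suc k) ^ 2 = 1 / fact k * real k + 1 / fact k" for k
    proof -
      have "1 / fact (Suc k) * real (Suc k) ^ 2 = real (Suc k) / fact k"
        unfolding fact_Suc power2_eq_square by (simp del: of_nat_Suc)
      then show ?thesis by (simp add: add_divide_distrib)
    qed
    then have "(\<lambda>k. 1 / fact (Suc k) * real (Suc k) ^ 2) sums (2 * exp 1)"
      using sums_add[OF s1 exp1] by (simp only: mult_1 mult_2 distrib_right one_add_one[symmetric])
    then show ?thesis by (rule sums_Suc_imp[rotated]) simp
  qed
  show "integrable M (\<lambda>\<omega>. real (X \<omega>))" "(\<integral>\<omega>. real (X \<omega>) \<partial>M) = 1"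
    using moment[OF _ s1] by (auto simp: has_bochner_integral_iff)
  show "integrable M (\<lambda>\<omega>. real (X \<omega>) ^ 2)" "(\<integral>\<omega>. real (X \<omega>) ^ 2 \<partial>M) = 2"
    using moment[OF _ s2] by (auto simp: has_bochner_integral_iff)
qed

lemma unit_cell_counts:
  assumes M: "prob_space M" and P: "homogeneous_poisson_process M 1 P"
    and N: "\<And>i \<omega>. N i \<omega> = card (P \<omega> \<inter> {b + real i..<b + real i + 1})"
  shows "prob_space.indep_vars M (\<lambda>_. borel) (\<lambda>i \<omega>. real (N i \<omega>)) {..<m}"
    and "\<And>i. i < m \<Longrightarrow> integrable M (\<lambda>\<omega>. real (N i \<omega>))"
    and "\<And>i. i < m \<Longrightarrow> (\<integral>\<omega>. real (N i \<omega>) \<partial>M) = 1"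
    and "\<And>i. i < m \<Longrightarrow> integrable M (\<lambda>\<omega>. real (N i \<omega>) ^ 2)"
    and "\<And>i. i < m \<Longrightarrow> (\<integral>\<omega>. real (N i \<omega>) ^ 2 \<partial>M) = 2"
proof -
  interpret prob_space M by fact
  define A where "A i = {b + real i..<b + real i + 1}" for i :: nat
  have A: "A i \<in> sets borel" "bounded (A i)" "measure lborel (A i) = 1" for i
    by (auto simp: A_def)
  have "disjoint_family_on A {..<m}"
  proof -
    have "i = j" if "x \<in> A i" "x \<in> A j" for x i j
    proof -
      have "\<lfloor>x - b\<rfloor> = int i" "\<lfloor>x - b\<rfloor> = int j"
        using that by (auto simp: A_def floor_eq_iff)
      then show ?thesis by simp
    qed
    then show ?thesis by (auto simp: disjoint_family_on_def)
  qed
  moreover have "(\<forall>i<m. B i \<in> sets borel \<and> bounded (B i)) \<and> disjoint_family_on B {..<m} \<longrightarrow>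
      indep_vars (\<lambda>_. count_space UNIV) (\<lambda>i \<omega>. card (P \<omega> \<inter> B i)) {..<m}" for B :: "nat \<Rightarrow> real set"
    using P unfolding homogeneous_poisson_process_def by simp
  ultimately have "indep_vars (\<lambda>_. count_space UNIV) (\<lambda>i \<omega>. card (P \<omega> \<inter> A i)) {..<m}"
    using A by simp
  then have ind: "indep_vars (\<lambda>_. count_space UNIV) (\<lambda>i \<omega>. N i \<omega>) {..<m}"
    unfolding N A_def .
  then show "indep_vars (\<lambda>_. borel) (\<lambda>i \<omega>. real (N i \<omega>)) {..<m}"
    by (rule indep_vars_compose2) auto
  fix i assume "i < m"
  then have X: "N i \<in> M \<rightarrow>\<^sub>M count_space UNIV"
    using ind by (auto simp: indep_vars_def)
  have "measure M {\<omega> \<in> space M. N i \<omega> = k} = 1 / fact k * exp (-1)" for k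
  proof -
    have "measure M {\<omega> \<in> space M. card (P \<omega> \<inter> A i) = k} =
        (1 * measure lborel (A i)) ^ k / fact k * exp (- (1 * measure lborel (A i)))"
      using P A(1,2) unfolding homogeneous_poisson_process_def by simp
    then show ?thesis unfolding N A(3) A_def[symmetric] by simp
  qed
  from poisson_one_moments[OF M X this]
  show "integrable M (\<lambda>\<omega>. real (N i \<omega>))" "(\<integral>\<omega>. real (N i \<omega>) \<partial>M) = 1"
    "integrable M (\<lambda>\<omega>. real (N i \<omega>) ^ 2)" "(\<integral>\<omega>. real (N i \<omega>) ^ 2 \<partial>M) = 2" .
qed


context prob_space begin

text \<open>By independence the expectation of a product of four counts factorises over the distinct indices.
  An index contributes the first moment 1 if it occurs once and the second moment 2 if it is shared by
  the two pairs, and at most two indices are shared.\<close>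
lemma expectation_prod_four:
  fixes Z :: "nat \<Rightarrow> 'a \<Rightarrow> real"
  assumes ind: "indep_vars (\<lambda>_. borel) Z {..<m}"
    and int1: "\<And>i. i < m \<Longrightarrow> integrable M (Z i)" and one: "\<And>i. i < m \<Longrightarrow> expectation (Z i) = 1"
    and int2: "\<And>i. i < m \<Longrightarrow> integrable M (\<lambda>\<omega>. Z i \<omega> ^ 2)"
    and two: "\<And>i. i < m \<Longrightarrow> expectation (\<lambda>\<omega>. Z i \<omega> ^ 2) = 2"
    and ij: "i < m" "j < m" "i \<noteq> j" and kl: "k < m" "l < m" "k \<noteq> l"
  shows "integrable M (\<lambda>\<omega>. (Z i \<omega> * Z j \<omega>) * (Z k \<omega> * Z l \<omega>))"
    and "expectation (\<lambda>\<omega>. (Z i \<omega> * Z j \<omega>) * (Z k \<omega> * Z l \<omega>)) \<le> (if {i, j} \<inter> {k, l} = {} then 1 else 4)"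
proof -
  \<comment> \<open>the multiplicity of the index \<open>t\<close> in the monomial\<close>
  define v :: "nat \<Rightarrow> nat" where
    "v t = (if t = i then 1 else 0) + (if t = j then 1 else 0) +
      (if t = k then 1 else 0) + (if t = l then 1 else 0)" for t
  have v: "v t = 0 \<or> v t = 1 \<or> v t = 2" for t
    using ij(3) kl(3) by (auto simp: v_def)
  have ind': "indep_vars (\<lambda>_. borel) (\<lambda>t \<omega>. Z t \<omega> ^ v t) {..<m}"
    by (rule indep_vars_compose2[OF ind]) auto
  have intv: "integrable M (\<lambda>\<omega>. Z t \<omega> ^ v t)" if "t < m" for t
    using v[of t] int1[OF that] int2[OF that] by auto
  have monomial: "(Z i \<omega> * Z j \<omega>) * (Z k \<omega> * Z l \<omega>) = (\<Prod>t<m. Z t \<omega> ^ v t)" for \<omega>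
  proof -
    have pow: "x ^ (if P then 1 else 0) = (if P then x else 1)" for x :: real and P by simp
    show ?thesis
      unfolding v_def power_add prod.distrib pow using ij kl by (simp add: mult_ac)
  qed
  show "integrable M (\<lambda>\<omega>. (Z i \<omega> * Z j \<omega>) * (Z k \<omega> * Z l \<omega>))"
    unfolding monomial using intv by (intro indep_vars_integrable ind') auto
  have "expectation (\<lambda>\<omega>. (Z i \<omega> * Z j \<omega>) * (Z k \<omega> * Z l \<omega>)) = (\<Prod>t<m. expectation (\<lambda>\<omega>. Z t \<omega> ^ v t))"
    unfolding monomial using intv by (intro indep_vars_lebesgue_integral ind') auto
  also have "\<dots> = (\<Prod>t<m. if v t = 2 then 2 else 1)"
    using v one two by (intro prod.cong refl) (force simp: prob_space)
  also have "\<dots> = (\<Prod>t\<in>{i, j}. if v t = 2 then 2 else 1)"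
    using ij kl by (intro prod.mono_neutral_right) (auto simp: v_def)
  also have "\<dots> \<le> (if {i, j} \<inter> {k, l} = {} then 1 else 4)"
    using ij by (auto simp: v_def)
  finally show "expectation (\<lambda>\<omega>. (Z i \<omega> * Z j \<omega>) * (Z k \<omega> * Z l \<omega>)) \<le> (if {i, j} \<inter> {k, l} = {} then 1 else 4)" .
qed

text \<open>Two products \<open>Z i * Z j\<close> and \<open>Z k * Z l\<close> with disjoint index pairs have expectation of product at most
  1, the product of the two means. So only pairs that share an index contribute to the variance, and
  for a fixed pair \<open>(i, j)\<close> the weights of those are controlled by the row and column sums through \<open>i\<close>
  and \<open>j\<close>. For a bounded mean the variance is thus small as soon as the expected number of long edges
  at a vertex is small.\<close>
lemma quadratic_form_moments:
  fixes Z :: "nat \<Rightarrow> 'a \<Rightarrow> real" and c :: "nat \<Rightarrow> nat \<Rightarrow> real"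
  assumes ind: "indep_vars (\<lambda>_. borel) Z {..<m}"
    and int1: "\<And>i. i < m \<Longrightarrow> integrable M (Z i)" and one: "\<And>i. i < m \<Longrightarrow> expectation (Z i) = 1"
    and int2: "\<And>i. i < m \<Longrightarrow> integrable M (\<lambda>\<omega>. Z i \<omega> ^ 2)"
    and two: "\<And>i. i < m \<Longrightarrow> expectation (\<lambda>\<omega>. Z i \<omega> ^ 2) = 2"
    and c0: "\<And>i j. 0 \<le> c i j" and diag: "\<And>i. c i i = 0"
    and R: "\<And>i. i < m \<Longrightarrow> (\<Sum>j<m. c i j) + (\<Sum>j<m. c j i) \<le> R"
  defines "X \<equiv> \<lambda>\<omega>. \<Sum>i<m. \<Sum>j<m. c i j * (Z i \<omega> * Z j \<omega>)"
    and "\<mu> \<equiv> \<Sum>i<m. \<Sum>j<m. c i j"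
  shows "integrable M X" and "expectation X = \<mu>"
    and "integrable M (\<lambda>\<omega>. (X \<omega> - \<mu>)\<^sup>2)" and "expectation (\<lambda>\<omega>. (X \<omega> - \<mu>)\<^sup>2) \<le> 6 * R * \<mu>"
proof -
  define I where "I = {..<m} \<times> {..<m}"
  define C where "C p = c (fst p) (snd p)" for p
  define Y where "Y p \<omega> = Z (fst p) \<omega> * Z (snd p) \<omega>" for p \<omega>
  define D where "D p q \<longleftrightarrow> {fst p, snd p} \<inter> {fst q, snd q} = {}" for p q :: "nat \<times> nat"
  have X: "X = (\<lambda>\<omega>. \<Sum>p\<in>I. C p * Y p \<omega>)"
    by (simp add: X_def fun_eq_iff I_def C_def Y_def sum.cartesian_product split_beta)
  have \<mu>: "\<mu> = (\<Sum>p\<in>I. C p)"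
    by (simp add: \<mu>_def I_def C_def sum.cartesian_product split_beta)
  have pair: "integrable M (\<lambda>\<omega>. C p * Y p \<omega>) \<and> expectation (\<lambda>\<omega>. C p * Y p \<omega>) = C p" if "p \<in> I" for p
  proof (cases "fst p = snd p")
    case True then show ?thesis by (simp add: C_def diag)
  next
    case False
    have in_m: "fst p < m" "snd p < m" using that by (auto simp: I_def)
    have "indep_vars (\<lambda>_. borel) Z {fst p, snd p}"
      using in_m by (intro indep_vars_subset[OF ind]) auto
    from indep_vars_lebesgue_integral[OF _ this] indep_vars_integrable[OF _ this]
    show ?thesis using one int1 in_m False by (force simp: Y_def)
  qed
  show int: "integrable M X" unfolding X using pair by auto
  show EX: "expectation X = \<mu>" unfolding X \<mu>
    by (subst Bochner_Integration.integral_sum) (use pair in \<open>blast intro: sum.cong\<close>)+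
  have four: "integrable M (\<lambda>\<omega>. (C p * Y p \<omega>) * (C q * Y q \<omega>)) \<and>
      expectation (\<lambda>\<omega>. (C p * Y p \<omega>) * (C q * Y q \<omega>)) \<le> C p * C q * (1 + (if D p q then 0 else 3))"
    if "p \<in> I" "q \<in> I" for p q
  proof (cases "fst p = snd p \<or> fst q = snd q")
    case True then show ?thesis by (auto simp: C_def diag)
  next
    case False
    have "fst p < m" "snd p < m" "fst q < m" "snd q < m" "fst p \<noteq> snd p" "fst q \<noteq> snd q"
      using that False by (auto simp: I_def)
    note E = expectation_prod_four[OF ind int1 one int2 two this(1,2,5,3,4,6)]
    have eq: "(\<lambda>\<omega>. (C p * Y p \<omega>) * (C q * Y q \<omega>)) = (\<lambda>\<omega>. (C p * C q) * (Y p \<omega> * Y q \<omega>))"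
      by (simp add: fun_eq_iff mult_ac)
    have "integrable M (\<lambda>\<omega>. Y p \<omega> * Y q \<omega>)" unfolding Y_def by (rule E(1))
    moreover have "expectation (\<lambda>\<omega>. Y p \<omega> * Y q \<omega>) \<le> 1 + (if D p q then 0 else 3)"
      using E(2) unfolding Y_def D_def by auto
    moreover have "0 \<le> C p * C q" by (simp add: C_def c0)
    ultimately show ?thesis unfolding eq
      by (simp only: integral_mult_right_zero integrable_mult_right mult_left_mono simp_thms)
  qed
  have X2: "(\<lambda>\<omega>. X \<omega> ^ 2) = (\<lambda>\<omega>. \<Sum>p\<in>I. \<Sum>q\<in>I. (C p * Y p \<omega>) * (C q * Y q \<omega>))"
    by (simp add: X power2_eq_square sum_product)
  have intX2: "integrable M (\<lambda>\<omega>. X \<omega> ^ 2)"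
    unfolding X2 using four by auto
  have sq: "(\<lambda>\<omega>. (X \<omega> - \<mu>)\<^sup>2) = (\<lambda>\<omega>. X \<omega> ^ 2 - 2 * \<mu> * X \<omega> + \<mu>\<^sup>2)"
    by (simp add: fun_eq_iff power2_eq_square algebra_simps)
  show "integrable M (\<lambda>\<omega>. (X \<omega> - \<mu>)\<^sup>2)"
    unfolding sq using int intX2 by auto
  have share: "(\<Sum>q\<in>I. C q * (if D p q then 0 else 3)) \<le> 6 * R" if p: "p \<in> I" for p
  proof -
    \<comment> \<open>the weight of \<open>q\<close>, counted once for each of its two entries equal to \<open>t\<close>\<close>
    define s where "s t q = (if fst q = t then C q else 0) + (if snd q = t then C q else 0)" for t q
    have s: "(\<Sum>q\<in>I. s t q) \<le> R" if "t < m" for t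
    proof -
      have "(\<Sum>q\<in>I. s t q) = (\<Sum>i<m. \<Sum>j<m. if i = t then c i j else 0) +
          (\<Sum>i<m. \<Sum>j<m. if j = t then c i j else 0)"
        unfolding s_def sum.distrib I_def C_def sum.cartesian_product by (simp add: split_beta)
      also have "\<dots> = (\<Sum>j<m. c t j) + (\<Sum>j<m. c j t)"
      proof -
        have "(\<Sum>i<m. \<Sum>j<m. if i = t then c i j else 0) = (\<Sum>j<m. \<Sum>i<m. if i = t then c i j else 0)"
          by (rule sum.swap)
        then show ?thesis using that by simp
      qed
      finally show ?thesis using R[OF that] by simp
    qed
    have "(\<Sum>q\<in>I. C q * (if D p q then 0 else 3)) \<le> (\<Sum>q\<in>I. 3 * (s (fst p) q + s (snd p) q))"
      by (intro sum_mono) (auto simp: s_def D_def C_def c0)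
    also have "\<dots> = 3 * ((\<Sum>q\<in>I. s (fst p) q) + (\<Sum>q\<in>I. s (snd p) q))"
      by (simp add: sum_distrib_left sum.distrib)
    also have "\<dots> \<le> 3 * (R + R)"
      using p by (intro mult_left_mono add_mono s) (auto simp: I_def)
    finally show ?thesis by simp
  qed
  have "expectation (\<lambda>\<omega>. X \<omega> ^ 2) = (\<Sum>p\<in>I. \<Sum>q\<in>I. expectation (\<lambda>\<omega>. (C p * Y p \<omega>) * (C q * Y q \<omega>)))"
    unfolding X2 using four
    by (simp add: Bochner_Integration.integral_sum Bochner_Integration.integrable_sum cong: sum.cong)
  also have "\<dots> \<le> (\<Sum>p\<in>I. \<Sum>q\<in>I. C p * C q * (1 + (if D p q then 0 else 3)))"
    using four by (intro sum_mono) auto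
  also have "\<dots> = \<mu>\<^sup>2 + (\<Sum>p\<in>I. C p * (\<Sum>q\<in>I. C q * (if D p q then 0 else 3)))"
    by (simp add: \<mu> power2_eq_square sum_product sum.distrib[symmetric] sum_distrib_left algebra_simps)
  also have "\<dots> \<le> \<mu>\<^sup>2 + (\<Sum>p\<in>I. C p * (6 * R))"
    using share by (intro add_left_mono sum_mono mult_left_mono) (auto simp: C_def c0)
  also have "\<dots> = \<mu>\<^sup>2 + 6 * R * \<mu>"
    by (simp only: \<mu> sum_distrib_right[symmetric] mult.commute)
  finally have "expectation (\<lambda>\<omega>. X \<omega> ^ 2) \<le> \<mu>\<^sup>2 + 6 * R * \<mu>" .
  moreover have "expectation (\<lambda>\<omega>. (X \<omega> - \<mu>)\<^sup>2) = expectation (\<lambda>\<omega>. X \<omega> ^ 2) - \<mu>\<^sup>2"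
  proof -
    have "expectation (\<lambda>\<omega>. (X \<omega> - \<mu>)\<^sup>2) = expectation (\<lambda>\<omega>. X \<omega> ^ 2) - 2 * \<mu> * expectation X + \<mu>\<^sup>2"
      unfolding sq using int intX2 by (simp add: prob_space)
    then show ?thesis by (simp add: EX power2_eq_square)
  qed
  ultimately show "expectation (\<lambda>\<omega>. (X \<omega> - \<mu>)\<^sup>2) \<le> 6 * R * \<mu>" by simp
qed

text \<open>Jensen's inequality for \<open>exp\<close>, in the form of its tangent at the mean.\<close>
lemma expectation_exp_neg_ge:
  fixes X :: "'a \<Rightarrow> real"
  assumes int: "integrable M X" and X0: "\<And>\<omega>. 0 \<le> X \<omega>"
  shows "exp (- expectation X) \<le> expectation (\<lambda>\<omega>. exp (- X \<omega>))"
proof -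
  let ?\<mu> = "expectation X"
  have int': "integrable M (\<lambda>\<omega>. exp (- X \<omega>))"
    using borel_measurable_integrable[OF int]
    by (intro integrable_const_bound[where B = 1] AE_I2) (simp_all add: X0)
  have "exp (- ?\<mu>) = expectation (\<lambda>\<omega>. exp (- ?\<mu>) * (1 - (X \<omega> - ?\<mu>)))"
    using int by (simp add: prob_space)
  also have "\<dots> \<le> expectation (\<lambda>\<omega>. exp (- X \<omega>))"
  proof (intro integral_mono int')
    fix \<omega>
    have "exp (- ?\<mu>) * (1 + (?\<mu> - X \<omega>)) \<le> exp (- ?\<mu>) * exp (?\<mu> - X \<omega>)"
      by (intro mult_left_mono exp_ge_add_one_self) auto
    then show "exp (- ?\<mu>) * (1 - (X \<omega> - ?\<mu>)) \<le> exp (- X \<omega>)"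
      by (simp add: mult_exp_exp algebra_simps)
  qed (use int in auto)
  finally show ?thesis .
qed

text \<open>On the nonnegative reals \<open>exp (- x)\<close> is 1-Lipschitz, and the mean absolute deviation is at most the
  standard deviation.\<close>
lemma expectation_exp_neg_le:
  fixes X :: "'a \<Rightarrow> real"
  assumes int: "integrable M X" and X0: "\<And>\<omega>. 0 \<le> X \<omega>" and \<mu>0: "0 \<le> \<mu>"
    and int2: "integrable M (\<lambda>\<omega>. (X \<omega> - \<mu>)\<^sup>2)"
  shows "expectation (\<lambda>\<omega>. exp (- X \<omega>)) \<le> exp (- \<mu>) + sqrt (expectation (\<lambda>\<omega>. (X \<omega> - \<mu>)\<^sup>2))"
proof -
  let ?V = "expectation (\<lambda>\<omega>. (X \<omega> - \<mu>)\<^sup>2)"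
  have int': "integrable M (\<lambda>\<omega>. exp (- X \<omega>))"
    using borel_measurable_integrable[OF int]
    by (intro integrable_const_bound[where B = 1] AE_I2) (simp_all add: X0)
  have inta: "integrable M (\<lambda>\<omega>. \<bar>X \<omega> - \<mu>\<bar>)" using int by auto
  have "exp (- x) \<le> exp (- \<mu>) + \<bar>x - \<mu>\<bar>" if "0 \<le> x" for x :: real
  proof (cases "x \<le> \<mu>")
    case True
    have "1 - (\<mu> - x) \<le> exp (- (\<mu> - x))" using exp_ge_add_one_self[of "- (\<mu> - x)"] by (simp only: minus_diff_eq diff_conv_add_uminus[symmetric])
    then have "1 - exp (x - \<mu>) \<le> \<mu> - x" by simp
    moreover have "1 - exp (x - \<mu>) \<ge> 0" using True by simp
    ultimately have "exp (- x) * (1 - exp (x - \<mu>)) \<le> 1 * (\<mu> - x)"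
      using that by (intro mult_mono) auto
    moreover have "exp (- x) * (1 - exp (x - \<mu>)) = exp (- x) - exp (- \<mu>)"
      by (simp add: algebra_simps mult_exp_exp)
    ultimately show ?thesis by simp
  next
    case False then show ?thesis by (auto intro: order_trans[of _ "exp (- \<mu>)"])
  qed
  then have "expectation (\<lambda>\<omega>. exp (- X \<omega>)) \<le> expectation (\<lambda>\<omega>. exp (- \<mu>) + \<bar>X \<omega> - \<mu>\<bar>)"
    using int' inta X0 by (intro integral_mono) auto
  also have "\<dots> = exp (- \<mu>) + expectation (\<lambda>\<omega>. \<bar>X \<omega> - \<mu>\<bar>)"
    using inta by (simp add: prob_space)
  also have "expectation (\<lambda>\<omega>. \<bar>X \<omega> - \<mu>\<bar>) \<le> sqrt ?V"
  proof (rule real_le_rsqrt)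
    let ?a = "expectation (\<lambda>\<omega>. \<bar>X \<omega> - \<mu>\<bar>)"
    have "0 \<le> expectation (\<lambda>\<omega>. (\<bar>X \<omega> - \<mu>\<bar> - ?a)\<^sup>2)" by simp
    also have "(\<lambda>\<omega>. (\<bar>X \<omega> - \<mu>\<bar> - ?a)\<^sup>2) = (\<lambda>\<omega>. (X \<omega> - \<mu>)\<^sup>2 - 2 * ?a * \<bar>X \<omega> - \<mu>\<bar> + ?a\<^sup>2)"
      by (simp add: fun_eq_iff power2_diff)
    also have "expectation \<dots> = ?V - 2 * ?a * ?a + ?a\<^sup>2"
      using inta int2 by (simp add: prob_space)
    finally show "?a\<^sup>2 \<le> ?V" by (simp add: power2_eq_square)
  qed
  finally show ?thesis by simp
qed

end


section \<open>The edge sets without long edges\<close>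

definition short_edge_sets :: "real \<Rightarrow> real set set set" where
  "short_edge_sets r =
     {F. finite F \<and> F \<subseteq> unordered_pairs UNIV \<and> (\<forall>x y. {x, y} \<in> F \<longrightarrow> \<bar>x - y\<bar> \<le> r)}"

text \<open>Having no edge longer than \<open>r\<close> says that no edge counts for the open set of pairs at distance more than
  \<open>r\<close>, so this event is one of the generators.\<close>
lemma short_edge_sets_measurable: "short_edge_sets r \<in> sets edge_configs"
proof -
  let ?\<Omega> = "{F. finite F \<and> F \<subseteq> unordered_pairs UNIV}"
  let ?C = "{p :: real \<times> real. r < \<bar>fst p - snd p\<bar>}"
  let ?B = "{F \<in> ?\<Omega>. card {e \<in> F. \<exists>x y. e = {x, y} \<and> (x, y) \<in> ?C} = 0}"
  have "open ?C" by (intro open_Collect_less continuous_intros)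
  then have "?C \<in> sets borel" by (rule borel_open)
  then have "?B \<in> sets edge_configs"
    unfolding edge_configs_def Let_def
    by (subst sets_measure_of) (auto intro!: sigma_sets.Basic exI[of _ "0::nat"] exI[of _ ?C])
  also have "?B = short_edge_sets r"
    by (auto simp: short_edge_sets_def not_less)
  finally show ?thesis .
qed

lemma finite_unordered_pairs: "finite p \<Longrightarrow> finite (unordered_pairs p)"
  by (rule finite_subset[of _ "Pow p"]) (auto simp: unordered_pairs_def)

lemma unordered_pairs_UNIV: "unordered_pairs p \<subseteq> unordered_pairs UNIV"
  by (auto simp: unordered_pairs_def)

lemma finite_edge_lengths:
  assumes "finite F" "F \<subseteq> unordered_pairs UNIV"
  shows "finite {\<bar>x - y\<bar> | x y. {x, y} \<in> (F :: real set set)}"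
proof (rule finite_subset)
  show "{\<bar>x - y\<bar> | x y. {x, y} \<in> F} \<subseteq> (\<lambda>e. Max e - Min e) ` F"
  proof clarify
    fix x y assume "{x, y} \<in> F"
    moreover have "\<bar>x - y\<bar> = Max {x, y} - Min {x, y}" by auto
    ultimately show "\<bar>x - y\<bar> \<in> (\<lambda>e. Max e - Min e) ` F" by blast
  qed
qed (use assms in auto)

lemma longest_edge_le_iff:
  assumes F: "finite F" "F \<subseteq> unordered_pairs UNIV" and r: "0 \<le> r"
  shows "longest_edge F \<le> r \<longleftrightarrow> F \<in> short_edge_sets r"
proof (cases "F = {}")
  case True then show ?thesis using r by (simp add: longest_edge_def short_edge_sets_def)
next
  case False
  then have "{\<bar>x - y\<bar> | x y. {x, y} \<in> F} \<noteq> {}"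
    using F(2) by (fastforce simp: unordered_pairs_def)
  then show ?thesis
    using False F finite_edge_lengths[OF F] by (auto simp: longest_edge_def short_edge_sets_def)
qed

lemma longest_edge_bounds:
  assumes p: "finite p" "p \<subseteq> {-c..c}" and F: "F \<subseteq> unordered_pairs p" "F \<noteq> {}"
  shows "0 < longest_edge F" "longest_edge F \<le> 2 * c"
proof -
  let ?L = "{\<bar>x - y\<bar> | x y. {x, y} \<in> F}"
  have "finite F" using finite_subset[OF F(1) finite_unordered_pairs[OF p(1)]] .
  moreover have "F \<subseteq> unordered_pairs UNIV" using F(1) unordered_pairs_UNIV by (rule subset_trans)
  ultimately have fin: "finite ?L" by (rule finite_edge_lengths)
  have edge: "x \<in> p \<and> y \<in> p \<and> x \<noteq> y" if "{x, y} \<in> F" for x y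
    using that F(1) by (auto simp: unordered_pairs_def doubleton_eq_iff)
  obtain x y where "{x, y} \<in> F" using F by (fastforce simp: unordered_pairs_def)
  then have ne: "?L \<noteq> {}" by auto
  have "Max ?L \<in> ?L" using fin ne by (rule Max_in)
  then obtain x y where xy: "Max ?L = \<bar>x - y\<bar>" "{x, y} \<in> F" by auto
  then have "x \<in> {-c..c}" "y \<in> {-c..c}" "x \<noteq> y" using edge[OF xy(2)] p(2) by blast+
  then show "0 < longest_edge F" "longest_edge F \<le> 2 * c"
    using F(2) xy(1) by (auto simp: longest_edge_def)
qed

text \<open>Given the vertices, the edges are independent, so the probability that all long pairs stay unconnected
  is a product over unordered pairs. Orienting every pair increasingly turns it into a double product
  over vertices; the condition \<open>r < y - x\<close> with \<open>0 \<le> r\<close> selects exactly one orientation.\<close>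
lemma prob_short_edge_sets:
  fixes g :: "real \<Rightarrow> real"
  assumes p: "finite p" and r: "0 \<le> r" and g: "\<And>x. g x \<in> {0..1}"
  shows "measure_pmf.prob (edge_law g p) (short_edge_sets r) =
    (\<Prod>x\<in>p. \<Prod>y\<in>p. if r < y - x then 1 - g (y - x) else 1)"
proof -
  let ?T = "{(x, y). x \<in> p \<and> y \<in> p \<and> x < y}"
  let ?B = "\<lambda>e. if r < Max e - Min e then {False} else (UNIV :: bool set)"
  have fin: "finite (unordered_pairs p)" using p by (rule finite_unordered_pairs)
  have len: "Max {x, y} - Min {x, y} = \<bar>x - y\<bar>" for x y :: real by auto
  have pre: "(\<lambda>b. {e \<in> unordered_pairs p. b e}) -` short_edge_sets r = Pi (unordered_pairs p) ?B"
  proof (intro set_eqI iffI)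
    fix b assume b: "b \<in> (\<lambda>b. {e \<in> unordered_pairs p. b e}) -` short_edge_sets r"
    show "b \<in> Pi (unordered_pairs p) ?B"
    proof
      fix e assume e: "e \<in> unordered_pairs p"
      then obtain x y where xy: "e = {x, y}" by (auto simp: unordered_pairs_def)
      moreover have "\<And>x y. {x, y} \<in> {e \<in> unordered_pairs p. b e} \<Longrightarrow> \<bar>x - y\<bar> \<le> r"
        using b unfolding short_edge_sets_def vimage_def by blast
      ultimately have "b e \<Longrightarrow> \<bar>x - y\<bar> \<le> r" using e by blast
      then show "b e \<in> ?B e" unfolding xy len by auto
    qed
  next
    fix b assume b: "b \<in> Pi (unordered_pairs p) ?B"
    have "\<bar>x - y\<bar> \<le> r" if "{x, y} \<in> unordered_pairs p" "b {x, y}" for x y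
    proof -
      have "b {x, y} \<in> ?B {x, y}" using b that(1) by (rule Pi_mem)
      then show ?thesis using that(2) unfolding len by (simp split: if_splits)
    qed
    then show "b \<in> (\<lambda>b. {e \<in> unordered_pairs p. b e}) -` short_edge_sets r"
      using fin unordered_pairs_UNIV[of p] by (auto simp: short_edge_sets_def)
  qed
  have img: "unordered_pairs p = (\<lambda>(x, y). {x, y}) ` ?T"
  proof -
    have "{x, y} \<in> (\<lambda>(x, y). {x, y}) ` ?T" if "x \<in> p" "y \<in> p" "x \<noteq> y" for x y
    proof (cases "x < y")
      case True
      then show ?thesis using that by (intro image_eqI[of _ _ "(x, y)"]) auto
    next
      case False
      then show ?thesis using that by (intro image_eqI[of _ _ "(y, x)"]) auto
    qed
    then show ?thesis by (auto simp: unordered_pairs_def)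
  qed
  have inj: "inj_on (\<lambda>(x, y). {x, y}) ?T"
    by (auto simp: inj_on_def doubleton_eq_iff)
  have "measure_pmf.prob (edge_law g p) (short_edge_sets r) =
      (\<Prod>e\<in>unordered_pairs p. measure_pmf.prob (bernoulli_pmf (g (Max e - Min e))) (?B e))"
    unfolding edge_law_def measure_map_pmf pre by (rule measure_Pi_pmf_Pi[OF fin])
  also have "\<dots> = (\<Prod>e\<in>unordered_pairs p. if r < Max e - Min e then 1 - g (Max e - Min e) else 1)"
    using g by (intro prod.cong refl) (auto simp: measure_pmf_single)
  also have "\<dots> = (\<Prod>(x, y)\<in>?T. if r < y - x then 1 - g (y - x) else 1)"
    unfolding img by (subst prod.reindex[OF inj], rule prod.cong) (auto simp: len)
  also have "\<dots> = (\<Prod>(x, y)\<in>p \<times> p. if r < y - x then 1 - g (y - x) else 1)"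
    using p r by (intro prod.mono_neutral_left) (auto split: if_splits)
  finally show ?thesis by (simp add: prod.cartesian_product)
qed

text \<open>Integrating the conditional law of the edges over the vertices. Since
  the conditional probability need not be visibly measurable in the configuration, it enters only
  through integrable bounds on either side.\<close>
lemma prob_edges_between:
  assumes M: "prob_space M" and G: "soft_random_graph M g Q E" and S: "S \<in> sets edge_configs"
  shows "integrable M L \<Longrightarrow> (\<And>\<omega>. \<omega> \<in> space M \<Longrightarrow> L \<omega> \<le> measure_pmf.prob (edge_law g (Q \<omega>)) S) \<Longrightarrow>
      (\<integral>\<omega>. L \<omega> \<partial>M) \<le> measure M {\<omega> \<in> space M. E \<omega> \<in> S}"
    and "integrable M H \<Longrightarrow> (\<And>\<omega>. \<omega> \<in> space M \<Longrightarrow> measure_pmf.prob (edge_law g (Q \<omega>)) S \<le> H \<omega>) \<Longrightarrow>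
      measure M {\<omega> \<in> space M. E \<omega> \<in> S} \<le> (\<integral>\<omega>. H \<omega> \<partial>M)"
proof -
  interpret prob_space M by fact
  let ?A = "{\<omega> \<in> space M. E \<omega> \<in> S}" and ?F = "vimage_algebra (space M) Q point_configs"
  have Q: "Q \<in> M \<rightarrow>\<^sub>M point_configs" and E: "E \<in> M \<rightarrow>\<^sub>M edge_configs"
    using G by (auto simp: soft_random_graph_def)
  interpret finite_measure_subalgebra M ?F
  proof unfold_locales
    show "subalgebra M ?F"
      unfolding subalgebra_def using Q by (auto simp: measurable_def sets_vimage_algebra2)
  qed
  have A: "?A \<in> sets M" using measurable_sets[OF E S] by (simp add: vimage_def Int_def conj_commute)
  have int: "integrable M (indicator ?A :: 'a \<Rightarrow> real)"
    using A by (intro integrable_real_indicator) (auto simp: less_top[symmetric])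
  let ?c = "real_cond_exp M ?F (indicator ?A)"
  have c: "integrable M ?c" "(\<integral>\<omega>. ?c \<omega> \<partial>M) = measure M ?A"
    using real_cond_exp_int[OF int] A by auto
  have ae: "AE \<omega> in M. ?c \<omega> = measure_pmf.prob (edge_law g (Q \<omega>)) S"
    using G S by (simp add: soft_random_graph_def)
  show "(\<integral>\<omega>. L \<omega> \<partial>M) \<le> measure M ?A"
    if "integrable M L" and L: "\<And>\<omega>. \<omega> \<in> space M \<Longrightarrow> L \<omega> \<le> measure_pmf.prob (edge_law g (Q \<omega>)) S"
  proof -
    have "AE \<omega> in M. L \<omega> \<le> ?c \<omega>" using ae AE_space by eventually_elim (use L in simp)
    then show ?thesis unfolding c(2)[symmetric] by (intro integral_mono_AE that(1) c(1))
  qed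
  show "measure M ?A \<le> (\<integral>\<omega>. H \<omega> \<partial>M)"
    if "integrable M H" and H: "\<And>\<omega>. \<omega> \<in> space M \<Longrightarrow> measure_pmf.prob (edge_law g (Q \<omega>)) S \<le> H \<omega>"
  proof -
    have "AE \<omega> in M. ?c \<omega> \<le> H \<omega>" using ae AE_space by eventually_elim (use H in simp)
    then show ?thesis unfolding c(2)[symmetric] by (intro integral_mono_AE that(1) c(1))
  qed
qed

section \<open>Comparison with the counts of unit cells\<close>

definition cell :: "real \<Rightarrow> real \<Rightarrow> nat" where
  "cell b x = nat \<lfloor>x - b\<rfloor>"

lemma sum_over_cells:
  fixes f :: "nat \<Rightarrow> real"
  assumes p: "finite p" "p \<subseteq> {b..<b + real m}"
  shows "(\<Sum>x\<in>p. f (cell b x)) = (\<Sum>i<m. real (card (p \<inter> {b + real i..<b + real i + 1})) * f i)"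
proof -
  have "cell b ` p \<subseteq> {..<m}"
  proof clarsimp
    fix x assume "x \<in> p"
    then have "b \<le> x" "x < b + real m" using p by auto
    then show "cell b x < m" unfolding cell_def by linarith
  qed
  then have "(\<Sum>x\<in>p. f (cell b x)) = (\<Sum>i<m. \<Sum>x\<in>{x \<in> p. cell b x = i}. f (cell b x))"
    using p by (intro sum.group[symmetric]) auto
  also have "\<dots> = (\<Sum>i<m. real (card (p \<inter> {b + real i..<b + real i + 1})) * f i)"
  proof (intro sum.cong refl)
    fix i
    have "{x \<in> p. cell b x = i} = p \<inter> {b + real i..<b + real i + 1}"
    proof (intro set_eqI iffI)
      fix x assume x: "x \<in> {x \<in> p. cell b x = i}"
      then have "0 \<le> \<lfloor>x - b\<rfloor>" using p by auto
      then have "\<lfloor>x - b\<rfloor> = int i" using x by (auto simp: cell_def)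
      then show "x \<in> p \<inter> {b + real i..<b + real i + 1}"
        using x by (auto simp: floor_eq_iff)
    next
      fix x assume x: "x \<in> p \<inter> {b + real i..<b + real i + 1}"
      then have "\<lfloor>x - b\<rfloor> = int i" by (auto simp: floor_eq_iff)
      then show "x \<in> {x \<in> p. cell b x = i}" using x by (auto simp: cell_def)
    qed
    moreover have "(\<Sum>x\<in>{x \<in> p. cell b x = i}. f (cell b x)) = real (card {x \<in> p. cell b x = i}) * f i"
      by simp
    ultimately show "(\<Sum>x\<in>{x \<in> p. cell b x = i}. f (cell b x)) =
        real (card (p \<inter> {b + real i..<b + real i + 1})) * f i"
      by simp
  qed
  finally show ?thesis .
qed

text \<open>A sum over pairs of points that depends only on the difference of the cell numbers is a quadratic form
  in the cell counts. The difference is the truncated one on \<open>nat\<close>; weights with \<open>a 0 = 0\<close> therefore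
  ignore all pairs whose second point is not in a later cell.\<close>
lemma pair_sum_over_cells:
  fixes a :: "nat \<Rightarrow> real"
  assumes p: "finite p" "p \<subseteq> {b..<b + real m}"
  defines "N \<equiv> \<lambda>i. real (card (p \<inter> {b + real i..<b + real i + 1}))"
  shows "(\<Sum>x\<in>p. \<Sum>y\<in>p. a (cell b y - cell b x)) = (\<Sum>i<m. \<Sum>j<m. a (j - i) * (N i * N j))"
proof -
  have "(\<Sum>x\<in>p. \<Sum>y\<in>p. a (cell b y - cell b x)) = (\<Sum>x\<in>p. \<Sum>j<m. N j * a (j - cell b x))"
    using sum_over_cells[OF p, of "\<lambda>j. a (j - cell b x)" for x] by (simp add: N_def)
  also have "\<dots> = (\<Sum>i<m. N i * (\<Sum>j<m. N j * a (j - i)))"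
    using sum_over_cells[OF p, of "\<lambda>i. \<Sum>j<m. N j * a (j - i)"] by (simp add: N_def)
  finally show ?thesis by (simp add: sum_distrib_left mult_ac)
qed

lemma cell_diff:
  assumes "b \<le> x" "b \<le> y" "cell b x \<le> cell b y"
  shows "\<bar>(y - x) - real (cell b y - cell b x)\<bar> < 1"
  using assms unfolding cell_def by linarith

text \<open>Lower bound for the conditional probability: the weight of two cells dominates
  \<open>- ln (1 - g t)\<close> at every distance \<open>t > r\<close> that two of their points can have. The cells may
  cover more than the vertex set, since extra points only decrease the bound.\<close>
lemma prob_short_ge:
  fixes a :: "nat \<Rightarrow> real"
  assumes p: "finite p" "p \<subseteq> {b..<b + real m}" and Q: "Q \<subseteq> p"
    and r: "1 \<le> r" and g: "\<And>x. g x \<in> {0..1}" and a: "\<And>d. 0 \<le> a d"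
    and ag: "\<And>d t. r < t \<Longrightarrow> \<bar>t - real d\<bar> < 1 \<Longrightarrow> exp (- a d) \<le> 1 - g t"
  defines "N \<equiv> \<lambda>i. real (card (p \<inter> {b + real i..<b + real i + 1}))"
  shows "exp (- (\<Sum>i<m. \<Sum>j<m. a (j - i) * (N i * N j))) \<le>
    measure_pmf.prob (edge_law g Q) (short_edge_sets r)"
proof -
  have finQ: "finite Q" using p(1) Q by (rule finite_subset[rotated])
  have "(\<Sum>x\<in>Q. \<Sum>y\<in>Q. a (cell b y - cell b x)) \<le> (\<Sum>x\<in>p. \<Sum>y\<in>p. a (cell b y - cell b x))"
    using p(1) Q a finQ unfolding sum.cartesian_product by (intro sum_mono2) auto
  then have "exp (- (\<Sum>i<m. \<Sum>j<m. a (j - i) * (N i * N j))) \<le> exp (- (\<Sum>x\<in>Q. \<Sum>y\<in>Q. a (cell b y - cell b x)))"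
    unfolding N_def pair_sum_over_cells[OF p, symmetric] by simp
  also have "\<dots> = (\<Prod>x\<in>Q. \<Prod>y\<in>Q. exp (- a (cell b y - cell b x)))"
    using finQ by (simp add: exp_sum sum_negf[symmetric])
  also have "\<dots> \<le> (\<Prod>x\<in>Q. \<Prod>y\<in>Q. if r < y - x then 1 - g (y - x) else 1)"
  proof (intro prod_mono conjI prod_nonneg)
    fix x y assume xy: "x \<in> Q" "y \<in> Q"
    show "exp (- a (cell b y - cell b x)) \<le> (if r < y - x then 1 - g (y - x) else 1)"
    proof (cases "r < y - x")
      case True
      have bx: "b \<le> x" "b \<le> y" using xy Q p(2) by auto
      have "cell b x \<le> cell b y" using True r bx unfolding cell_def by linarith
      from ag[OF True cell_diff[OF bx this]] True show ?thesis by simp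
    qed (simp add: a)
  qed auto
  also have "\<dots> = measure_pmf.prob (edge_law g Q) (short_edge_sets r)"
    using prob_short_edge_sets[OF finQ _ g] r by simp
  finally show ?thesis .
qed

text \<open>Upper bound for the conditional probability: a nonzero weight is allowed only for two cells all of whose
  pairs are longer than \<open>r\<close>, and it must be below \<open>- ln (1 - g t)\<close> at all their distances. The cells
  may cover only part of the vertex set, since the other factors are at most 1.\<close>
lemma prob_short_le:
  fixes a :: "nat \<Rightarrow> real"
  assumes p: "p \<subseteq> {b..<b + real m}" and Q: "finite Q" "p \<subseteq> Q"
    and r: "0 \<le> r" and g: "\<And>x. g x \<in> {0..1}" and a: "\<And>d. 0 \<le> a d" and a0: "a 0 = 0"
    and ag: "\<And>d t. a d \<noteq> 0 \<Longrightarrow> \<bar>t - real d\<bar> < 1 \<Longrightarrow> r < t \<and> 1 - g t \<le> exp (- a d)"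
  defines "N \<equiv> \<lambda>i. real (card (p \<inter> {b + real i..<b + real i + 1}))"
  shows "measure_pmf.prob (edge_law g Q) (short_edge_sets r) \<le>
    exp (- (\<Sum>i<m. \<Sum>j<m. a (j - i) * (N i * N j)))"
proof -
  have finp: "finite p" using Q by (rule finite_subset[rotated])
  let ?f = "\<lambda>(x, y). if r < y - x then 1 - g (y - x) else 1"
  have f01: "0 \<le> ?f q \<and> ?f q \<le> 1" for q using g by (auto simp: split_beta)
  have "measure_pmf.prob (edge_law g Q) (short_edge_sets r) = (\<Prod>q\<in>Q \<times> Q. ?f q)"
    by (simp add: prob_short_edge_sets[OF Q(1) r g] prod.cartesian_product)
  also have "Q \<times> Q = p \<times> p \<union> (Q \<times> Q - p \<times> p)" using Q by auto
  also have "prod ?f (p \<times> p \<union> (Q \<times> Q - p \<times> p)) = prod ?f (p \<times> p) * prod ?f (Q \<times> Q - p \<times> p)"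
    using finp Q(1) by (intro prod.union_disjoint) auto
  also have "\<dots> \<le> prod ?f (p \<times> p) * 1"
    using f01 by (intro mult_left_mono prod_le_1 prod_nonneg) auto
  also have "\<dots> \<le> (\<Prod>(x, y)\<in>p \<times> p. exp (- a (cell b y - cell b x)))"
    unfolding mult_1_right
  proof (intro prod_mono conjI)
    fix q assume q: "q \<in> p \<times> p"
    obtain x y where xy: "q = (x, y)" by (cases q)
    have "?f (x, y) \<le> exp (- a (cell b y - cell b x))"
    proof (cases "a (cell b y - cell b x) = 0")
      case True then show ?thesis using f01[of "(x, y)"] by simp
    next
      case False
      then have "cell b x \<le> cell b y" using a0 by (cases "cell b x \<le> cell b y") auto
      moreover have "b \<le> x" "b \<le> y" using q xy p by auto
      ultimately show ?thesis using ag[OF False cell_diff] by auto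
    qed
    then show "?f q \<le> (case q of (x, y) \<Rightarrow> exp (- a (cell b y - cell b x)))" by (simp add: xy)
  qed (use f01 in auto)
  also have "\<dots> = exp (- (\<Sum>x\<in>p. \<Sum>y\<in>p. a (cell b y - cell b x)))"
    using finp by (simp add: exp_sum sum_negf[symmetric] prod.cartesian_product)
  also have "\<dots> = exp (- (\<Sum>i<m. \<Sum>j<m. a (j - i) * (N i * N j)))"
    unfolding N_def pair_sum_over_cells[OF finp p] ..
  finally show ?thesis .
qed

text \<open>Among \<open>m\<close> consecutive cells there are \<open>m - d\<close> ordered pairs at distance \<open>d\<close>.\<close>
lemma sum_differences:
  fixes a :: "nat \<Rightarrow> real"
  assumes "a 0 = 0"
  shows "(\<Sum>i<m. \<Sum>j<m. a (j - i)) = (\<Sum>d<m. (real m - real d) * a d)"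
proof (induction m)
  case (Suc m)
  have "(\<Sum>i<Suc m. \<Sum>j<Suc m. a (j - i)) = (\<Sum>i<Suc m. \<Sum>j<m. a (j - i)) + (\<Sum>i<Suc m. a (m - i))"
    by (simp add: sum.distrib)
  also have "(\<Sum>i<Suc m. \<Sum>j<m. a (j - i)) = (\<Sum>i<m. \<Sum>j<m. a (j - i))"
    using assms by simp
  also have "(\<Sum>i<Suc m. a (m - i)) = (\<Sum>d<Suc m. a d)"
    using sum.nat_diff_reindex[of a "Suc m"] by simp
  also have "(\<Sum>i<m. \<Sum>j<m. a (j - i)) + (\<Sum>d<Suc m. a d) = (\<Sum>d<Suc m. (real (Suc m) - real d) * a d)"
    unfolding Suc.IH by (simp add: sum.distrib[symmetric] algebra_simps)
  finally show ?case .
qed simp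

lemma sum_row_col:
  fixes a :: "nat \<Rightarrow> real"
  assumes "a 0 = 0" "\<And>d. 0 \<le> a d" "i < m"
  shows "(\<Sum>j<m. a (j - i)) + (\<Sum>j<m. a (i - j)) \<le> 2 * (\<Sum>d<m. a d)"
proof -
  have "(\<Sum>j<m. a (j - i)) = (\<Sum>j\<in>{i..<m}. a (j - i))"
    using assms by (intro sum.mono_neutral_right) auto
  also have "\<dots> = (\<Sum>d\<in>(\<lambda>j. j - i) ` {i..<m}. a d)"
    by (subst sum.reindex) (auto simp: inj_on_def)
  also have "\<dots> \<le> (\<Sum>d<m. a d)"
    using assms by (intro sum_mono2) auto
  finally have row: "(\<Sum>j<m. a (j - i)) \<le> (\<Sum>d<m. a d)" .
  have "(\<Sum>j<m. a (i - j)) = (\<Sum>j\<in>{..i}. a (i - j))"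
    using assms by (intro sum.mono_neutral_right) auto
  also have "\<dots> = (\<Sum>d\<in>(\<lambda>j. i - j) ` {..i}. a d)"
    by (subst sum.reindex) (auto simp: inj_on_def)
  also have "\<dots> \<le> (\<Sum>d<m. a d)"
    using assms by (intro sum_mono2) auto
  finally show ?thesis using row by simp
qed

locale poisson_random_graph = prob_space M for M :: "'a measure" +
  fixes P :: "'a \<Rightarrow> real set" and g :: "real \<Rightarrow> real" and n :: nat and E :: "'a \<Rightarrow> real set set"
  assumes P: "homogeneous_poisson_process M 1 P"
    and g: "\<And>x. g x \<in> {0..1}"
    and E: "soft_random_graph M g (\<lambda>\<omega>. P \<omega> \<inter> {- real n..real n}) E"
begin

lemma finite_points: "\<omega> \<in> space M \<Longrightarrow> bounded K \<Longrightarrow> finite (P \<omega> \<inter> K)"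
proof -
  assume \<omega>: "\<omega> \<in> space M" and K: "bounded K"
  have "P \<in> M \<rightarrow>\<^sub>M point_configs" using P by (simp add: homogeneous_poisson_process_def)
  then have "P \<omega> \<in> space point_configs" using \<omega> by (rule measurable_space)
  moreover have "space point_configs = {p. \<forall>K. bounded K \<longrightarrow> finite (p \<inter> K)}"
    unfolding point_configs_def Let_def by (rule space_measure_of) auto
  ultimately show ?thesis using K by simp
qed

definition N :: "nat \<Rightarrow> 'a \<Rightarrow> real" where
  "N i \<omega> = real (card (P \<omega> \<inter> {- real n + real i..<- real n + real i + 1}))"

lemma weighted_pair_count_moments:
  fixes a :: "nat \<Rightarrow> real" and m :: nat
  assumes a: "\<And>d. 0 \<le> a d" and a0: "a 0 = 0"
  defines "X \<equiv> \<lambda>\<omega>. \<Sum>i<m. \<Sum>j<m. a (j - i) * (N i \<omega> * N j \<omega>)"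
    and "\<mu> \<equiv> \<Sum>d<m. (real m - real d) * a d"
  shows "integrable M X" "expectation X = \<mu>" "integrable M (\<lambda>\<omega>. (X \<omega> - \<mu>)\<^sup>2)"
    "expectation (\<lambda>\<omega>. (X \<omega> - \<mu>)\<^sup>2) \<le> 12 * (\<Sum>d<m. a d) * \<mu>"
    "\<And>\<omega>. 0 \<le> X \<omega>" "0 \<le> \<mu>"
proof -
  note cells = unit_cell_counts[OF prob_space_axioms P, where m = m and b = "- real n" and
      N = "\<lambda>i \<omega>. card (P \<omega> \<inter> {- real n + real i..<- real n + real i + 1})", OF refl, folded N_def]
  have ind: "indep_vars (\<lambda>_. borel) N {..<m}"
    using cells(1) by (simp add: N_def[abs_def])
  have R: "(\<Sum>j<m. a (j - i)) + (\<Sum>j<m. a (i - j)) \<le> 2 * (\<Sum>d<m. a d)" if "i < m" for i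
    using a0 a that by (rule sum_row_col)
  note q = quadratic_form_moments[OF ind cells(2-5), where c = "\<lambda>i j. a (j - i)" and R = "2 * (\<Sum>d<m. a d)",
      unfolded sum_differences[of a, OF a0] diff_self_eq_0]
  show "integrable M X" unfolding X_def by (rule q(1)) (use R a a0 in simp_all)
  show "expectation X = \<mu>" unfolding X_def \<mu>_def by (rule q(2)) (use R a a0 in simp_all)
  show "integrable M (\<lambda>\<omega>. (X \<omega> - \<mu>)\<^sup>2)"
    unfolding X_def \<mu>_def by (rule q(3)) (use R a a0 in simp_all)
  have "expectation (\<lambda>\<omega>. (X \<omega> - \<mu>)\<^sup>2) \<le> 6 * (2 * (\<Sum>d<m. a d)) * \<mu>"
    unfolding X_def \<mu>_def by (rule q(4)) (use R a a0 in simp_all)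
  then show "expectation (\<lambda>\<omega>. (X \<omega> - \<mu>)\<^sup>2) \<le> 12 * (\<Sum>d<m. a d) * \<mu>" by simp
  show X0: "0 \<le> X \<omega>" for \<omega>
    unfolding X_def by (intro sum_nonneg mult_nonneg_nonneg a) (auto simp: N_def)
  show "0 \<le> \<mu>" unfolding \<mu>_def by (intro sum_nonneg mult_nonneg_nonneg a) auto
qed

text \<open>The closed window \<open>[- n, n]\<close> is covered by the \<open>2 * n + 1\<close> cells starting at \<open>- n\<close>, the last one being
  needed for the right endpoint.\<close>
lemma prob_no_long_edge_ge:
  fixes a :: "nat \<Rightarrow> real"
  assumes r: "1 \<le> r" and a: "\<And>d. 0 \<le> a d" and a0: "a 0 = 0"
    and ag: "\<And>d t. r < t \<Longrightarrow> \<bar>t - real d\<bar> < 1 \<Longrightarrow> exp (- a d) \<le> 1 - g t"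
  shows "exp (- (\<Sum>d<2 * n + 1. (real (2 * n + 1) - real d) * a d)) \<le>
    prob {\<omega> \<in> space M. E \<omega> \<in> short_edge_sets r}"
proof -
  define m where "m = 2 * n + 1"
  define X where "X \<omega> = (\<Sum>i<m. \<Sum>j<m. a (j - i) * (N i \<omega> * N j \<omega>))" for \<omega>
  note mom = weighted_pair_count_moments[where a = a and m = m, OF a a0, folded X_def]
  have "exp (- (\<Sum>d<m. (real m - real d) * a d)) \<le> expectation (\<lambda>\<omega>. exp (- X \<omega>))"
    using expectation_exp_neg_ge[OF mom(1,5)] unfolding mom(2) .
  also have "\<dots> \<le> prob {\<omega> \<in> space M. E \<omega> \<in> short_edge_sets r}"
  proof (rule prob_edges_between(1)[OF prob_space_axioms E short_edge_sets_measurable])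
    show "integrable M (\<lambda>\<omega>. exp (- X \<omega>))"
      using borel_measurable_integrable[OF mom(1)]
      by (intro integrable_const_bound[where B = 1] AE_I2) (simp_all add: mom(5))
  next
    fix \<omega> assume \<omega>: "\<omega> \<in> space M"
    let ?p = "P \<omega> \<inter> {- real n..<- real n + real m}"
    have "?p \<inter> {- real n + real i..<- real n + real i + 1} = P \<omega> \<inter> {- real n + real i..<- real n + real i + 1}"
      if "i < m" for i
      using that by auto
    then have X: "X \<omega> = (\<Sum>i<m. \<Sum>j<m. a (j - i) * (real (card (?p \<inter> {- real n + real i..<- real n + real i + 1})) *
        real (card (?p \<inter> {- real n + real j..<- real n + real j + 1}))))"
      unfolding X_def N_def by (intro sum.cong refl) simp
    show "exp (- X \<omega>) \<le> measure_pmf.prob (edge_law g (P \<omega> \<inter> {- real n..real n})) (short_edge_sets r)"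
      unfolding X
    proof (rule prob_short_ge[where g = g and a = a, OF _ _ _ r g a ag])
      show "finite ?p" by (rule finite_points[OF \<omega>]) simp
      show "P \<omega> \<inter> {- real n..real n} \<subseteq> ?p" by (auto simp: m_def)
    qed auto
  qed
  finally show ?thesis by (simp only: m_def)
qed

text \<open>Here \<open>2 * n - 1\<close> cells inside the window are used instead of the \<open>2 * n\<close> available ones. After the shift
  \<open>t = d + 1\<close> the number \<open>2 * n - 1 - d\<close> of cell pairs becomes \<open>2 * n - t\<close>, the same factor that
  \<open>t = d - 1\<close> produces from the \<open>2 * n + 1\<close> cells of the lower bound.\<close>
lemma prob_no_long_edge_le:
  fixes a :: "nat \<Rightarrow> real"
  assumes r: "0 \<le> r" and a: "\<And>d. 0 \<le> a d" and a0: "a 0 = 0" and n: "0 < n"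
    and ag: "\<And>d t. a d \<noteq> 0 \<Longrightarrow> \<bar>t - real d\<bar> < 1 \<Longrightarrow> r < t \<and> 1 - g t \<le> exp (- a d)"
  defines "\<mu> \<equiv> \<Sum>d<2 * n - 1. (real (2 * n - 1) - real d) * a d"
  shows "prob {\<omega> \<in> space M. E \<omega> \<in> short_edge_sets r} \<le> exp (- \<mu>) + sqrt (12 * (\<Sum>d<2 * n - 1. a d) * \<mu>)"
proof -
  define m where "m = 2 * n - 1"
  define X where "X \<omega> = (\<Sum>i<m. \<Sum>j<m. a (j - i) * (N i \<omega> * N j \<omega>))" for \<omega>
  note mom = weighted_pair_count_moments[where a = a and m = m, OF a a0, folded X_def, folded \<mu>_def[folded m_def]]
  have "prob {\<omega> \<in> space M. E \<omega> \<in> short_edge_sets r} \<le> expectation (\<lambda>\<omega>. exp (- X \<omega>))"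
  proof (rule prob_edges_between(2)[OF prob_space_axioms E short_edge_sets_measurable])
    show "integrable M (\<lambda>\<omega>. exp (- X \<omega>))"
      using borel_measurable_integrable[OF mom(1)]
      by (intro integrable_const_bound[where B = 1] AE_I2) (simp_all add: mom(5))
  next
    fix \<omega> assume \<omega>: "\<omega> \<in> space M"
    let ?p = "P \<omega> \<inter> {- real n..<- real n + real m}"
    have "?p \<inter> {- real n + real i..<- real n + real i + 1} = P \<omega> \<inter> {- real n + real i..<- real n + real i + 1}"
      if "i < m" for i
      using that by auto
    then have X: "X \<omega> = (\<Sum>i<m. \<Sum>j<m. a (j - i) * (real (card (?p \<inter> {- real n + real i..<- real n + real i + 1})) *
        real (card (?p \<inter> {- real n + real j..<- real n + real j + 1}))))"
      unfolding X_def N_def by (intro sum.cong refl) simp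
    show "measure_pmf.prob (edge_law g (P \<omega> \<inter> {- real n..real n})) (short_edge_sets r) \<le> exp (- X \<omega>)"
      unfolding X
    proof (rule prob_short_le[where g = g and a = a, OF _ _ _ r g a a0 ag])
      show "finite (P \<omega> \<inter> {- real n..real n})" by (rule finite_points[OF \<omega>]) simp
      show "?p \<subseteq> P \<omega> \<inter> {- real n..real n}" using n by (auto simp: m_def of_nat_diff)
    qed auto
  qed
  also have "\<dots> \<le> exp (- \<mu>) + sqrt (expectation (\<lambda>\<omega>. (X \<omega> - \<mu>)\<^sup>2))"
    by (rule expectation_exp_neg_le[OF mom(1,5,6,3)])
  also have "\<dots> \<le> exp (- \<mu>) + sqrt (12 * (\<Sum>d<m. a d) * \<mu>)"
    using mom(4) by simp
  finally show ?thesis by (simp only: m_def)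
qed

end

section \<open>The probability of having no long edge\<close>

lemma one_minus_connection_bounds:
  fixes g :: "real \<Rightarrow> real" and \<alpha> \<epsilon> :: real
  assumes lim: "((\<lambda>x. g x / \<bar>x\<bar> powr (- \<alpha>)) \<longlongrightarrow> 1) at_infinity" and \<alpha>: "0 < \<alpha>" and \<epsilon>: "0 < \<epsilon>"
  shows "eventually (\<lambda>t. exp (- ((1 + \<epsilon>) * t powr (- \<alpha>))) \<le> 1 - g t \<and>
    1 - g t \<le> exp (- ((1 - \<epsilon>) * t powr (- \<alpha>)))) at_top"
proof -
  have "at_top \<le> (at_infinity :: real filter)" by (simp add: at_infinity_eq_at_top_bot)
  then have lim': "((\<lambda>t. g t / \<bar>t\<bar> powr (- \<alpha>)) \<longlongrightarrow> 1) at_top"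
    using lim by (rule tendsto_mono)
  have u0: "((\<lambda>t :: real. t powr (- \<alpha>)) \<longlongrightarrow> 0) at_top"
    using \<alpha> by (intro tendsto_neg_powr filterlim_ident) auto
  define \<eta> where "\<eta> = 1 + \<epsilon> / 2"
  have c: "0 < \<epsilon> / (4 * \<eta>\<^sup>2)" "0 < 1 / (2 * \<eta>)" using \<epsilon> by (auto simp: \<eta>_def)
  have "eventually (\<lambda>t. 1 - \<epsilon> < g t / \<bar>t\<bar> powr (- \<alpha>)) at_top"
    "eventually (\<lambda>t. g t / \<bar>t\<bar> powr (- \<alpha>) < \<eta>) at_top"
    using \<epsilon> by (intro order_tendstoD[OF lim']; simp add: \<eta>_def)+
  moreover have "eventually (\<lambda>t. t powr (- \<alpha>) < \<epsilon> / (4 * \<eta>\<^sup>2)) at_top" "eventually (\<lambda>t. t powr (- \<alpha>) < 1 / (2 * \<eta>)) at_top"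
    using c by (intro order_tendstoD(2)[OF u0]; simp)+
  ultimately show ?thesis
    using eventually_gt_at_top[of 0]
  proof eventually_elim
    case (elim t)
    define u where "u = t powr (- \<alpha>)"
    have u: "0 < u" using elim(5) by (simp add: u_def)
    have lo: "(1 - \<epsilon>) * u \<le> g t" and hi: "g t \<le> \<eta> * u"
      using elim(1,2,5) u by (simp_all add: u_def[symmetric] field_simps)
    have "1 - g t \<le> 1 + (- ((1 - \<epsilon>) * u))" using lo by simp
    also have "\<dots> \<le> exp (- ((1 - \<epsilon>) * u))" by (rule exp_ge_add_one_self)
    finally have up: "1 - g t \<le> exp (- ((1 - \<epsilon>) * u))" .
    define v where "v = \<eta> * u"
    have \<eta>: "0 < \<eta>" using \<epsilon> by (simp add: \<eta>_def)
    have v: "0 \<le> v" "v \<le> 1 / 2"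
      using u \<eta> elim(4) unfolding v_def u_def[symmetric] by (auto simp: field_simps)
    have "2 * v\<^sup>2 \<le> \<epsilon> / 2 * u"
    proof -
      have "2 * v\<^sup>2 = (2 * \<eta>\<^sup>2 * u) * u" by (simp add: v_def power2_eq_square)
      also have "\<dots> \<le> \<epsilon> / 2 * u"
        using elim(3) u \<eta> unfolding u_def[symmetric] by (intro mult_right_mono) (auto simp: field_simps)
      finally show ?thesis .
    qed
    then have "- ((1 + \<epsilon>) * u) \<le> - v - 2 * v\<^sup>2" by (simp add: v_def \<eta>_def algebra_simps)
    also have "\<dots> \<le> ln (1 - v)" by (rule ln_one_minus_pos_lower_bound[OF v])
    finally have "exp (- ((1 + \<epsilon>) * u)) \<le> exp (ln (1 - v))" by simp
    also have "\<dots> = 1 - v" using v by simp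
    also have "\<dots> \<le> 1 - g t" using hi by (simp add: v_def)
    finally show ?case using up by (simp add: u_def)
  qed
qed

text \<open>Up to discretisation, the expected number of pairs at distance at least \<open>k\<close> that are connected: the
  integral of \<open>(2 * n - t) * t powr (- \<alpha>)\<close> over \<open>t\<close> from \<open>k\<close> to \<open>2 * n\<close>.\<close>
definition tail_intensity :: "real \<Rightarrow> nat \<Rightarrow> nat \<Rightarrow> real" where
  "tail_intensity \<alpha> n k = (\<Sum>t\<in>{k..<2 * n}. (2 * real n - real t) * real t powr (- \<alpha>))"

text \<open>Up to discretisation and a factor at most 2, the largest expected number of neighbours of a vertex at
  distance at least \<open>k\<close>.\<close>
definition tail_degree :: "real \<Rightarrow> nat \<Rightarrow> nat \<Rightarrow> real" where
  "tail_degree \<alpha> n k = (\<Sum>t\<in>{k..<2 * n}. real t powr (- \<alpha>))"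

text \<open>Two points in cells at distance \<open>d\<close> are more than \<open>d - 1\<close> apart, so the weight is read off at
  \<open>d - 1\<close>. All cell pairs that can contain a pair longer than \<open>r\<close> must be included, which leads to
  \<open>t = d - 1 \<ge> r - 2\<close>.\<close>
lemma (in poisson_random_graph) prob_no_long_edge_ge_tail:
  assumes r: "4 \<le> r" and \<alpha>: "0 < \<alpha>" and \<epsilon>: "0 < \<epsilon>"
    and ag: "\<And>t. r < t \<Longrightarrow> exp (- ((1 + \<epsilon>) * t powr (- \<alpha>))) \<le> 1 - g t"
  shows "exp (- ((1 + \<epsilon>) * tail_intensity \<alpha> n (nat \<lceil>r - 2\<rceil>))) \<le> prob {\<omega> \<in> space M. E \<omega> \<in> short_edge_sets r}"
proof -
  define k where "k = nat \<lceil>r - 2\<rceil>"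
  have k: "2 \<le> k" using r unfolding k_def by linarith
  define a where "a d = (if k + 1 \<le> d then (1 + \<epsilon>) * (real d - 1) powr (- \<alpha>) else 0)" for d :: nat
  have "exp (- (\<Sum>d<2 * n + 1. (real (2 * n + 1) - real d) * a d)) \<le>
      prob {\<omega> \<in> space M. E \<omega> \<in> short_edge_sets r}"
  proof (rule prob_no_long_edge_ge)
    fix d :: nat and t assume t: "r < t" "\<bar>t - real d\<bar> < 1"
    then have "k + 1 \<le> d" using r unfolding k_def by linarith
    moreover have "t powr (- \<alpha>) \<le> (real d - 1) powr (- \<alpha>)"
      using t r \<alpha> by (intro powr_mono2') auto
    ultimately have "(1 + \<epsilon>) * t powr (- \<alpha>) \<le> a d"
      using \<epsilon> by (auto simp: a_def)
    then have "exp (- a d) \<le> exp (- ((1 + \<epsilon>) * t powr (- \<alpha>)))" by simp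
    then show "exp (- a d) \<le> 1 - g t" using ag[OF t(1)] by linarith
  qed (use r \<epsilon> in \<open>auto simp: a_def\<close>)
  also have "(\<Sum>d<2 * n + 1. (real (2 * n + 1) - real d) * a d) = (1 + \<epsilon>) * tail_intensity \<alpha> n k"
  proof -
    have "(\<Sum>d<Suc (2 * n). (real (2 * n + 1) - real d) * a d) = (\<Sum>t<2 * n. (2 * real n - real t) * a (Suc t))"
      by (subst sum.lessThan_Suc_shift) (simp add: a_def)
    also have "\<dots> = (\<Sum>t\<in>{k..<2 * n}. (2 * real n - real t) * a (Suc t))"
      by (rule sum.mono_neutral_right) (auto simp: a_def)
    also have "\<dots> = (1 + \<epsilon>) * tail_intensity \<alpha> n k"
      unfolding tail_intensity_def sum_distrib_left by (intro sum.cong) (auto simp: a_def)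
    finally show ?thesis by simp
  qed
  finally show ?thesis unfolding k_def .
qed

text \<open>Two points in cells at distance \<open>d\<close> are less than \<open>d + 1\<close> apart, so the weight is read off at
  \<open>d + 1\<close>. Only cell pairs all of whose pairs are longer than \<open>r\<close> may be included, which leads to
  \<open>t = d + 1 \<ge> r + 2\<close>.\<close>
lemma (in poisson_random_graph) prob_no_long_edge_le_tail:
  assumes r: "4 \<le> r" and \<alpha>: "0 < \<alpha>" and \<epsilon>: "0 < \<epsilon>" "\<epsilon> < 1" and n: "0 < n"
    and ag: "\<And>t. r < t \<Longrightarrow> 1 - g t \<le> exp (- ((1 - \<epsilon>) * t powr (- \<alpha>)))"
  defines "k \<equiv> nat \<lceil>r + 2\<rceil>"
  shows "prob {\<omega> \<in> space M. E \<omega> \<in> short_edge_sets r} \<le>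
    exp (- ((1 - \<epsilon>) * tail_intensity \<alpha> n k)) + sqrt (12 * tail_degree \<alpha> n k * tail_intensity \<alpha> n k)"
proof -
  have k: "2 \<le> k" using r unfolding k_def by linarith
  define a where "a d = (if k \<le> d + 1 then (1 - \<epsilon>) * (real d + 1) powr (- \<alpha>) else 0)" for d :: nat
  define \<mu> where "\<mu> = (\<Sum>d<2 * n - 1. (real (2 * n - 1) - real d) * a d)"
  define \<rho> where "\<rho> = (\<Sum>d<2 * n - 1. a d)"
  have a0: "0 \<le> a d" for d using \<epsilon> by (simp add: a_def)
  have shift: "(\<Sum>d<2 * n - 1. f (Suc d)) = (\<Sum>t\<in>{k..<2 * n}. f t)" if "\<And>t. t < k \<Longrightarrow> f t = 0"
    for f :: "nat \<Rightarrow> real"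
  proof -
    have "2 * n = Suc (2 * n - 1)" using n by simp
    then have "(\<Sum>t<2 * n. f t) = f 0 + (\<Sum>d<2 * n - 1. f (Suc d))"
      by (metis sum.lessThan_Suc_shift)
    moreover have "(\<Sum>t<2 * n. f t) = (\<Sum>t\<in>{k..<2 * n}. f t)"
      using that by (intro sum.mono_neutral_right) auto
    moreover have "f 0 = 0" using k by (intro that) simp
    ultimately show ?thesis by simp
  qed
  have \<mu>: "\<mu> = (1 - \<epsilon>) * tail_intensity \<alpha> n k"
  proof -
    have "\<mu> = (\<Sum>d<2 * n - 1. (\<lambda>t. if k \<le> t then (1 - \<epsilon>) * ((2 * real n - real t) * real t powr (- \<alpha>)) else 0) (Suc d))"
      unfolding \<mu>_def using n by (intro sum.cong) (auto simp: a_def of_nat_diff algebra_simps)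
    also have "\<dots> = (1 - \<epsilon>) * tail_intensity \<alpha> n k"
      unfolding tail_intensity_def sum_distrib_left by (subst shift) auto
    finally show ?thesis .
  qed
  have \<rho>: "\<rho> = (1 - \<epsilon>) * tail_degree \<alpha> n k"
  proof -
    have "\<rho> = (\<Sum>d<2 * n - 1. (\<lambda>t. if k \<le> t then (1 - \<epsilon>) * real t powr (- \<alpha>) else 0) (Suc d))"
      unfolding \<rho>_def by (intro sum.cong) (auto simp: a_def algebra_simps)
    also have "\<dots> = (1 - \<epsilon>) * tail_degree \<alpha> n k"
      unfolding tail_degree_def sum_distrib_left by (subst shift) auto
    finally show ?thesis .
  qed
  have S0: "0 \<le> tail_intensity \<alpha> n k" "0 \<le> tail_degree \<alpha> n k"
    unfolding tail_intensity_def tail_degree_def by (auto intro!: sum_nonneg mult_nonneg_nonneg)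
  have "prob {\<omega> \<in> space M. E \<omega> \<in> short_edge_sets r} \<le> exp (- \<mu>) + sqrt (12 * \<rho> * \<mu>)"
    unfolding \<mu>_def \<rho>_def
  proof (rule prob_no_long_edge_le)
    fix d :: nat and t assume "a d \<noteq> 0" and t: "\<bar>t - real d\<bar> < 1"
    then have d: "k \<le> d + 1" by (auto simp: a_def split: if_splits)
    then have rt: "r < t" using t r unfolding k_def by linarith
    have "(real d + 1) powr (- \<alpha>) \<le> t powr (- \<alpha>)"
      using t r rt \<alpha> by (intro powr_mono2') auto
    then have "a d \<le> (1 - \<epsilon>) * t powr (- \<alpha>)"
      using d \<epsilon> by (auto simp: a_def)
    then have "exp (- ((1 - \<epsilon>) * t powr (- \<alpha>))) \<le> exp (- a d)" by simp
    then show "r < t \<and> 1 - g t \<le> exp (- a d)" using rt ag[OF rt] by linarith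
  qed (use r k n a0 in \<open>auto simp: a_def\<close>)
  also have "12 * \<rho> * \<mu> \<le> 12 * tail_degree \<alpha> n k * tail_intensity \<alpha> n k"
    unfolding \<mu> \<rho> using S0 \<epsilon>
    by (intro mult_mono mult_left_le_one_le mult_nonneg_nonneg) (auto simp: mult.left_commute[of 12] intro!: mult_left_le_one_le)
  finally show ?thesis unfolding \<mu> by simp
qed

text \<open>The two bounds on the probability differ by factors \<open>1 \<plusminus> \<epsilon>\<close> in the exponent, by a shift of at most
  4 in the threshold, and by a standard deviation. The hypothesis on all sequences \<open>k\<close> near \<open>r\<close> makes the
  shift and the standard deviation negligible, and \<open>\<epsilon>\<close> is arbitrary.\<close>
lemma prob_no_long_edge_tendsto:
  fixes g :: "real \<Rightarrow> real" and E :: "nat \<Rightarrow> 'a \<Rightarrow> real set set"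
  assumes graph: "\<And>n. poisson_random_graph M P g n (E n)"
    and lim: "((\<lambda>x. g x / \<bar>x\<bar> powr (- \<alpha>)) \<longlongrightarrow> 1) at_infinity" and \<alpha>: "0 < \<alpha>"
    and r: "filterlim r at_top sequentially"
    and S: "\<And>k. eventually (\<lambda>n. \<bar>real (k n) - r n\<bar> \<le> 4) sequentially \<Longrightarrow>
      (\<lambda>n. tail_intensity \<alpha> n (k n)) \<longlonglongrightarrow> \<Lambda> \<and> (\<lambda>n. tail_degree \<alpha> n (k n)) \<longlonglongrightarrow> 0"
  shows "(\<lambda>n. measure M {\<omega> \<in> space M. E n \<omega> \<in> short_edge_sets (r n)}) \<longlonglongrightarrow> exp (- \<Lambda>)"
proof -
  let ?p = "\<lambda>n. measure M {\<omega> \<in> space M. E n \<omega> \<in> short_edge_sets (r n)}"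
  have r4: "eventually (\<lambda>n. 4 \<le> r n) sequentially" using r by (auto simp: filterlim_at_top)
  have "eventually (\<lambda>n. \<bar>real (nat \<lceil>r n - 2\<rceil>) - r n\<bar> \<le> 4) sequentially"
    using r4 by eventually_elim linarith
  note S1 = S[OF this, THEN conjunct1]
  have "eventually (\<lambda>n. \<bar>real (nat \<lceil>r n + 2\<rceil>) - r n\<bar> \<le> 4) sequentially"
    using r4 by eventually_elim linarith
  note S2 = S[OF this, THEN conjunct1] and D2 = S[OF this, THEN conjunct2]
  have bounds: "eventually (\<lambda>n. exp (- ((1 + \<epsilon>) * tail_intensity \<alpha> n (nat \<lceil>r n - 2\<rceil>))) \<le> ?p n \<and>
      ?p n \<le> exp (- ((1 - \<epsilon>) * tail_intensity \<alpha> n (nat \<lceil>r n + 2\<rceil>))) +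
        sqrt (12 * tail_degree \<alpha> n (nat \<lceil>r n + 2\<rceil>) * tail_intensity \<alpha> n (nat \<lceil>r n + 2\<rceil>))) sequentially"
    if \<epsilon>: "0 < \<epsilon>" "\<epsilon> < 1" for \<epsilon>
  proof -
    obtain T where T: "\<And>t. T \<le> t \<Longrightarrow> exp (- ((1 + \<epsilon>) * t powr (- \<alpha>))) \<le> 1 - g t \<and>
        1 - g t \<le> exp (- ((1 - \<epsilon>) * t powr (- \<alpha>)))"
      using one_minus_connection_bounds[OF lim \<alpha> \<epsilon>(1)] by (auto simp: eventually_at_top_linorder)
    have "eventually (\<lambda>n. T \<le> r n) sequentially" using r by (auto simp: filterlim_at_top)
    then show ?thesis
      using r4 eventually_gt_at_top[of 0]
    proof eventually_elim
      case (elim n)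
      interpret poisson_random_graph M P g n "E n" by (rule graph)
      show ?case
        using prob_no_long_edge_ge_tail[OF elim(2) \<alpha> \<epsilon>(1)]
          prob_no_long_edge_le_tail[OF elim(2) \<alpha> \<epsilon> elim(3)] T elim(1) by auto
    qed
  qed
  have lo: "(\<lambda>n. exp (- ((1 + \<epsilon>) * tail_intensity \<alpha> n (nat \<lceil>r n - 2\<rceil>)))) \<longlonglongrightarrow> exp (- ((1 + \<epsilon>) * \<Lambda>))" for \<epsilon>
    by (intro tendsto_intros S1)
  have hi: "(\<lambda>n. exp (- ((1 - \<epsilon>) * tail_intensity \<alpha> n (nat \<lceil>r n + 2\<rceil>))) +
        sqrt (12 * tail_degree \<alpha> n (nat \<lceil>r n + 2\<rceil>) * tail_intensity \<alpha> n (nat \<lceil>r n + 2\<rceil>)))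
      \<longlonglongrightarrow> exp (- ((1 - \<epsilon>) * \<Lambda>)) + sqrt (12 * 0 * \<Lambda>)" for \<epsilon>
    by (intro tendsto_intros S2 D2)
  have pos: "eventually (\<lambda>\<epsilon> :: real. 0 < \<epsilon> \<and> \<epsilon> < 1) (at_right 0)"
    using eventually_at_right_less[of 0] eventually_at_right_real[of 0 1] by (auto elim: eventually_elim2)
  have e1: "((\<lambda>\<epsilon>. exp (- ((1 + \<epsilon>) * \<Lambda>))) \<longlongrightarrow> exp (- ((1 + 0) * \<Lambda>))) (at_right 0)"
    and e2: "((\<lambda>\<epsilon>. exp (- ((1 - \<epsilon>) * \<Lambda>))) \<longlongrightarrow> exp (- ((1 - 0) * \<Lambda>))) (at_right 0)"
    by (intro tendsto_intros)+
  show ?thesis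
  proof (rule order_tendstoI)
    fix c assume "c < exp (- \<Lambda>)"
    then have "eventually (\<lambda>\<epsilon>. c < exp (- ((1 + \<epsilon>) * \<Lambda>))) (at_right 0)"
      using order_tendstoD(1)[OF e1] by simp
    with pos have "eventually (\<lambda>\<epsilon>. (0 < \<epsilon> \<and> \<epsilon> < 1) \<and> c < exp (- ((1 + \<epsilon>) * \<Lambda>))) (at_right 0)"
      by (rule eventually_conj)
    then obtain \<epsilon> where \<epsilon>: "0 < \<epsilon>" "\<epsilon> < 1" "c < exp (- ((1 + \<epsilon>) * \<Lambda>))"
      using eventually_happens'[OF trivial_limit_at_right_real] by blast
    from order_tendstoD(1)[OF lo \<epsilon>(3)] bounds[OF \<epsilon>(1,2)]
    show "eventually (\<lambda>n. c < ?p n) sequentially" by eventually_elim linarith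
  next
    fix c assume "exp (- \<Lambda>) < c"
    then have "eventually (\<lambda>\<epsilon>. exp (- ((1 - \<epsilon>) * \<Lambda>)) < c) (at_right 0)"
      using order_tendstoD(2)[OF e2] by simp
    with pos have "eventually (\<lambda>\<epsilon>. (0 < \<epsilon> \<and> \<epsilon> < 1) \<and> exp (- ((1 - \<epsilon>) * \<Lambda>)) < c) (at_right 0)"
      by (rule eventually_conj)
    then obtain \<epsilon> where \<epsilon>: "0 < \<epsilon>" "\<epsilon> < 1" "exp (- ((1 - \<epsilon>) * \<Lambda>)) < c"
      using eventually_happens'[OF trivial_limit_at_right_real] by blast
    have "exp (- ((1 - \<epsilon>) * \<Lambda>)) + sqrt (12 * 0 * \<Lambda>) < c" using \<epsilon>(3) by simp
    from order_tendstoD(2)[OF hi this] bounds[OF \<epsilon>(1,2)]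
    show "eventually (\<lambda>n. ?p n < c) sequentially" by eventually_elim linarith
  qed
qed

section \<open>Asymptotics of the expected number of long edges\<close>

lemma sum_antimono_bounds:
  fixes f G :: "real \<Rightarrow> real" and k m :: nat
  assumes k: "2 \<le> k" "k \<le> m"
    and deriv: "\<And>t. 0 < t \<Longrightarrow> (G has_real_derivative f t) (at t)"
    and anti: "\<And>s t. 0 < s \<Longrightarrow> s \<le> t \<Longrightarrow> t \<le> real m \<Longrightarrow> f t \<le> f s"
  shows "G (real m) - G (real k) \<le> (\<Sum>t\<in>{k..<m}. f (real t))"
    and "(\<Sum>t\<in>{k..<m}. f (real t)) \<le> G (real m - 1) - G (real k - 1)"
proof -
  have mvt: "f (a + 1) \<le> G (a + 1) - G a \<and> G (a + 1) - G a \<le> f a" if "0 < a" "a + 1 \<le> real m" for a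
  proof -
    have "\<exists>z>a. z < a + 1 \<and> G (a + 1) - G a = (a + 1 - a) * f z"
      by (rule MVT2) (use deriv that in auto)
    then obtain z where z: "a < z" "z < a + 1" "G (a + 1) - G a = f z" by auto
    then show ?thesis using anti[of z "a + 1"] anti[of a z] that by auto
  qed
  have "G (real m) - G (real k) = (\<Sum>t\<in>{k..<m}. G (real (Suc t)) - G (real t))"
    using sum_Suc_diff'[OF k(2), of "\<lambda>t. G (real t)"] by simp
  also have "\<dots> \<le> (\<Sum>t\<in>{k..<m}. f (real t))"
    using mvt[of "real t" for t] k by (intro sum_mono) (auto simp: add.commute)
  finally show "G (real m) - G (real k) \<le> (\<Sum>t\<in>{k..<m}. f (real t))" .
  have "f (real t) \<le> G (real (Suc t) - 1) - G (real t - 1)" if "t \<in> {k..<m}" for t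
    using mvt[of "real t - 1"] k that by auto
  then have "(\<Sum>t\<in>{k..<m}. f (real t)) \<le> (\<Sum>t\<in>{k..<m}. G (real (Suc t) - 1) - G (real t - 1))"
    by (rule sum_mono)
  also have "\<dots> = G (real m - 1) - G (real k - 1)"
    using sum_Suc_diff'[OF k(2), of "\<lambda>t. G (real t - 1)"] by simp
  finally show "(\<Sum>t\<in>{k..<m}. f (real t)) \<le> G (real m - 1) - G (real k - 1)" .
qed

lemma tail_intensity_bounds:
  fixes G :: "real \<Rightarrow> real"
  assumes k: "2 \<le> k" "k \<le> 2 * n" and \<alpha>: "0 < \<alpha>"
    and deriv: "\<And>t. 0 < t \<Longrightarrow> (G has_real_derivative (2 * real n - t) * t powr (- \<alpha>)) (at t)"
  shows "G (2 * real n) - G (real k) \<le> tail_intensity \<alpha> n k"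
    and "tail_intensity \<alpha> n k \<le> G (2 * real n) - G (real k - 1)"
proof -
  let ?f = "\<lambda>t. (2 * real n - t) * t powr (- \<alpha>)"
  have anti: "?f t \<le> ?f s" if "0 < s" "s \<le> t" "t \<le> real (2 * n)" for s t
    using that \<alpha> by (intro mult_mono powr_mono2') auto
  note b = sum_antimono_bounds[OF k deriv anti]
  show "G (2 * real n) - G (real k) \<le> tail_intensity \<alpha> n k"
    using b(1) by (simp add: tail_intensity_def)
  have "G (2 * real n - 1) \<le> G (2 * real n)"
  proof (rule DERIV_nonneg_imp_nondecreasing[where f = G])
    fix t assume "2 * real n - 1 \<le> t" "t \<le> 2 * real n"
    then show "\<exists>y. (G has_real_derivative y) (at t) \<and> 0 \<le> y"
      using k by (intro exI[of _ "?f t"] conjI deriv) auto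
  qed simp
  then show "tail_intensity \<alpha> n k \<le> G (2 * real n) - G (real k - 1)"
    using b(2) by (simp add: tail_intensity_def)
qed

lemma tail_degree_le:
  assumes k: "2 \<le> k" and \<alpha>: "1 < \<alpha>"
  shows "tail_degree \<alpha> n k \<le> (real k - 1) powr (1 - \<alpha>) / (\<alpha> - 1)"
proof (cases "k \<le> 2 * n")
  case True
  let ?G = "\<lambda>t. t powr (1 - \<alpha>) / (1 - \<alpha>)"
  have "tail_degree \<alpha> n k \<le> ?G (real (2 * n) - 1) - ?G (real k - 1)"
    unfolding tail_degree_def
  proof (rule sum_antimono_bounds(2)[OF k True])
    show "(?G has_real_derivative t powr (- \<alpha>)) (at t)" if "0 < t" for t
      using that \<alpha> by (auto intro!: derivative_eq_intros)
  qed (use \<alpha> in \<open>auto intro: powr_mono2'\<close>)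
  also have "\<dots> \<le> - ?G (real k - 1)" using \<alpha> by (simp add: divide_nonneg_neg)
  also have "\<dots> = (real k - 1) powr (1 - \<alpha>) / (\<alpha> - 1)"
    using \<alpha> by (simp add: field_simps)
  finally show ?thesis .
next
  case False then show ?thesis using \<alpha> by (simp add: tail_degree_def)
qed

lemma tail_degree_nonneg: "0 \<le> tail_degree \<alpha> n k"
  by (simp add: tail_degree_def sum_nonneg)

lemma tail_degree_tendsto_0:
  assumes k: "filterlim k at_top sequentially" and \<alpha>: "1 < \<alpha>"
  shows "(\<lambda>n. tail_degree \<alpha> n (k n)) \<longlonglongrightarrow> 0"
proof (rule tendsto_sandwich[where f = "\<lambda>_. 0"])
  have "filterlim (\<lambda>n. -1 + real (k n)) at_top sequentially"
    by (intro filterlim_tendsto_add_at_top[OF tendsto_const] filterlim_compose[OF filterlim_real_sequentially k])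
  then have "(\<lambda>n. (-1 + real (k n)) powr (1 - \<alpha>)) \<longlonglongrightarrow> 0"
    using \<alpha> by (intro tendsto_neg_powr) auto
  from tendsto_divide[OF this tendsto_const, of "\<alpha> - 1"]
  show "(\<lambda>n. (real (k n) - 1) powr (1 - \<alpha>) / (\<alpha> - 1)) \<longlonglongrightarrow> 0"
    using \<alpha> by simp
  show "eventually (\<lambda>n. tail_degree \<alpha> n (k n) \<le> (real (k n) - 1) powr (1 - \<alpha>) / (\<alpha> - 1)) sequentially"
    using k[unfolded filterlim_at_top, rule_format, of 2]
    by eventually_elim (rule tail_degree_le[OF _ \<alpha>])
qed (auto simp: tail_degree_nonneg)

lemma near_filterlim_at_top:
  assumes r: "filterlim r at_top sequentially"
    and k: "eventually (\<lambda>n. \<bar>real (k n) - r n\<bar> \<le> 4) sequentially"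
  shows "filterlim k at_top sequentially"
proof -
  have "eventually (\<lambda>n. Z \<le> k n) sequentially" for Z
    using r[unfolded filterlim_at_top, rule_format, of "real Z + 4"] k by eventually_elim linarith
  then show ?thesis by (simp add: filterlim_at_top)
qed

lemma near_ratio_tendsto_1:
  assumes r: "filterlim r at_top sequentially"
    and q: "eventually (\<lambda>n. \<bar>q n - r n\<bar> \<le> 5) sequentially"
  shows "(\<lambda>n. q n / r n) \<longlonglongrightarrow> (1 :: real)"
proof -
  have "(\<lambda>n. (q n - r n) / r n) \<longlonglongrightarrow> 0"
  proof (rule Lim_null_comparison)
    show "(\<lambda>n. 5 / r n) \<longlonglongrightarrow> 0" by (intro tendsto_divide_0[OF tendsto_const] filterlim_at_top_imp_at_infinity r)
    show "eventually (\<lambda>n. norm ((q n - r n) / r n) \<le> 5 / r n) sequentially"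
      using q r[unfolded filterlim_at_top, rule_format, of 1]
      by eventually_elim (auto simp: divide_right_mono)
  qed
  from tendsto_add[OF this tendsto_const[of 1]]
  have "(\<lambda>n. (q n - r n) / r n + 1) \<longlonglongrightarrow> 1" by simp
  moreover have "eventually (\<lambda>n. (q n - r n) / r n + 1 = q n / r n) sequentially"
    using r[unfolded filterlim_at_top, rule_format, of 1] by eventually_elim (auto simp: field_simps)
  ultimately show ?thesis by (rule Lim_transform_eventually)
qed

text \<open>Criterion in terms of an antiderivative \<open>G\<close> of the intensity. The upper bound involves \<open>k n - 1\<close>
  rather than \<open>k n\<close>, whence the 5 where the sequence \<open>k\<close> only has a 4.\<close>
lemma tail_intensity_tendsto:
  fixes G :: "nat \<Rightarrow> real \<Rightarrow> real"
  assumes r: "filterlim r at_top sequentially" and \<alpha>: "0 < \<alpha>"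
    and deriv: "\<And>n t. 0 < t \<Longrightarrow> (G n has_real_derivative (2 * real n - t) * t powr (- \<alpha>)) (at t)"
    and lim: "\<And>q. eventually (\<lambda>n. \<bar>q n - r n\<bar> \<le> 5) sequentially \<Longrightarrow>
      (\<lambda>n. G n (2 * real n) - G n (q n)) \<longlonglongrightarrow> L"
    and in_window: "eventually (\<lambda>n. r n + 4 \<le> 2 * real n) sequentially"
    and k: "eventually (\<lambda>n. \<bar>real (k n) - r n\<bar> \<le> 4) sequentially"
  shows "(\<lambda>n. tail_intensity \<alpha> n (k n)) \<longlonglongrightarrow> L"
proof (rule tendsto_sandwich)
  have k2: "eventually (\<lambda>n. 2 \<le> k n \<and> k n \<le> 2 * n) sequentially"
    using r[unfolded filterlim_at_top, rule_format, of 6] in_window k by eventually_elim linarith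
  show "eventually (\<lambda>n. G n (2 * real n) - G n (real (k n)) \<le> tail_intensity \<alpha> n (k n)) sequentially"
    using k2 by eventually_elim (use deriv \<alpha> in \<open>auto intro: tail_intensity_bounds\<close>)
  show "eventually (\<lambda>n. tail_intensity \<alpha> n (k n) \<le> G n (2 * real n) - G n (real (k n) - 1)) sequentially"
    using k2 by eventually_elim (use deriv \<alpha> in \<open>auto intro: tail_intensity_bounds\<close>)
  show "(\<lambda>n. G n (2 * real n) - G n (real (k n))) \<longlonglongrightarrow> L"
    by (rule lim) (use k in eventually_elim, linarith)
  show "(\<lambda>n. G n (2 * real n) - G n (real (k n) - 1)) \<longlonglongrightarrow> L"
    by (rule lim) (use k in eventually_elim, linarith)
qed

text \<open>For \<open>\<alpha> > 2\<close> the longest edge is much shorter than the window. In the antiderivative only the term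
  \<open>2 * n * r powr (1 - \<alpha>) / (\<alpha> - 1)\<close> survives, and \<open>r\<close> is chosen to make it equal to \<open>L\<close>.\<close>
lemma tail_intensity_tendsto_gt_2:
  assumes \<alpha>: "2 < \<alpha>" and L: "0 < L"
  defines "r \<equiv> \<lambda>n. (L * (\<alpha> - 1) / (2 * real n)) powr (1 / (1 - \<alpha>))"
  shows "filterlim r at_top sequentially"
    and "eventually (\<lambda>n. \<bar>real (k n) - r n\<bar> \<le> 4) sequentially \<Longrightarrow> (\<lambda>n. tail_intensity \<alpha> n (k n)) \<longlonglongrightarrow> L"
proof -
  let ?G = "\<lambda>n t. 2 * real n * (t powr (1 - \<alpha>) / (1 - \<alpha>)) - t powr (2 - \<alpha>) / (2 - \<alpha>)"
  have c: "0 < L * (\<alpha> - 1)" using \<alpha> L by simp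
  have "filterlim (\<lambda>n. (b / (2 * real n)) powr p) at_top sequentially" if "p < 0" "0 < b" for b p :: real
    using that by real_asymp
  then show r: "filterlim r at_top sequentially"
    unfolding r_def using \<alpha> c by simp
  have r_powr: "2 * real n * r n powr (1 - \<alpha>) = L * (\<alpha> - 1)" if "0 < n" for n
    using \<alpha> c that by (simp add: r_def powr_powr)
  have qpowr: "(\<lambda>n. 2 * real n * q n powr (1 - \<alpha>)) \<longlonglongrightarrow> L * (\<alpha> - 1)"
    and qlim: "filterlim q at_top sequentially"
    if q: "eventually (\<lambda>n. \<bar>q n - r n\<bar> \<le> 5) sequentially" for q
  proof -
    have "filterlim (\<lambda>n. -5 + r n) at_top sequentially"
      by (rule filterlim_tendsto_add_at_top[OF tendsto_const r])
    then show qlim: "filterlim q at_top sequentially"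
      by (rule filterlim_at_top_mono) (use q in eventually_elim, linarith)
    have "(\<lambda>n. (q n / r n) powr (1 - \<alpha>) * (L * (\<alpha> - 1))) \<longlonglongrightarrow> 1 powr (1 - \<alpha>) * (L * (\<alpha> - 1))"
      by (intro tendsto_intros near_ratio_tendsto_1[OF r q]) auto
    moreover have "eventually (\<lambda>n. (q n / r n) powr (1 - \<alpha>) * (L * (\<alpha> - 1)) = 2 * real n * q n powr (1 - \<alpha>)) sequentially"
      using qlim[unfolded filterlim_at_top, rule_format, of 1]
        r[unfolded filterlim_at_top, rule_format, of 1] eventually_gt_at_top[of 0]
    proof eventually_elim
      case (elim n)
      then show ?case unfolding r_powr[OF elim(3), symmetric] by (simp add: powr_divide)
    qed
    ultimately show "(\<lambda>n. 2 * real n * q n powr (1 - \<alpha>)) \<longlonglongrightarrow> L * (\<alpha> - 1)"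
      by (simp add: Lim_transform_eventually)
  qed
  assume k: "eventually (\<lambda>n. \<bar>real (k n) - r n\<bar> \<le> 4) sequentially"
  show "(\<lambda>n. tail_intensity \<alpha> n (k n)) \<longlonglongrightarrow> L"
  proof (rule tail_intensity_tendsto[OF r, where G = ?G])
    fix n and t :: real assume "0 < t"
    then show "(?G n has_real_derivative (2 * real n - t) * t powr (- \<alpha>)) (at t)"
    proof -
      have d: "((\<lambda>t. t powr p / p) has_real_derivative t powr (p - 1)) (at t)" if "p \<noteq> 0" for p
        using that \<open>0 < t\<close> by (auto intro!: derivative_eq_intros)
      have "(?G n has_real_derivative 2 * real n * t powr (1 - \<alpha> - 1) - t powr (2 - \<alpha> - 1)) (at t)"
        using \<alpha> by (intro DERIV_diff DERIV_cmult d) auto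
      moreover have "t powr (2 - \<alpha> - 1) = t * t powr (- \<alpha>)"
        using \<open>0 < t\<close> by (simp add: powr_mult_base)
      ultimately show ?thesis by (simp add: left_diff_distrib)
    qed
  next
    fix q assume q: "eventually (\<lambda>n. \<bar>q n - r n\<bar> \<le> 5) sequentially"
    have at_end: "(\<lambda>n. ?G n (2 * real n)) \<longlonglongrightarrow> 0"
    proof -
      have "(\<lambda>n. (2 * real n) powr (2 - \<alpha>) * (1 / (1 - \<alpha>) - 1 / (2 - \<alpha>))) \<longlonglongrightarrow> 0 * (1 / (1 - \<alpha>) - 1 / (2 - \<alpha>))"
      proof (intro tendsto_intros)
        have "filterlim (\<lambda>n. 2 * real n) at_top sequentially" by real_asymp
        then show "(\<lambda>n. (2 * real n) powr (2 - \<alpha>)) \<longlonglongrightarrow> 0"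
          using \<alpha> by (intro tendsto_neg_powr) auto
      qed
      moreover have "(2 * real n) powr (2 - \<alpha>) * (1 / (1 - \<alpha>) - 1 / (2 - \<alpha>)) = ?G n (2 * real n)" for n
        using powr_mult_base[of "2 * real n" "1 - \<alpha>"] by (simp add: right_diff_distrib)
      ultimately show ?thesis by simp
    qed
    have "(\<lambda>n. 2 * real n * q n powr (1 - \<alpha>) / (1 - \<alpha>) - q n powr (2 - \<alpha>) / (2 - \<alpha>)) \<longlonglongrightarrow>
        L * (\<alpha> - 1) / (1 - \<alpha>) - 0 / (2 - \<alpha>)"
      using \<alpha> by (intro tendsto_intros qpowr[OF q] tendsto_neg_powr qlim[OF q]) auto
    moreover have "L * (\<alpha> - 1) / (1 - \<alpha>) = - L" using \<alpha> by (simp add: field_simps)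
    ultimately have "(\<lambda>n. ?G n (q n)) \<longlonglongrightarrow> - L" by simp
    from tendsto_diff[OF at_end this]
    show "(\<lambda>n. ?G n (2 * real n) - ?G n (q n)) \<longlonglongrightarrow> L" by simp
  next
    have "(\<lambda>n. r n powr (2 - \<alpha>)) \<longlonglongrightarrow> 0"
      using \<alpha> by (intro tendsto_neg_powr r) auto
    then have "eventually (\<lambda>n. r n powr (2 - \<alpha>) < L * (\<alpha> - 1) / 2) sequentially"
      by (rule order_tendstoD) (use c in simp)
    then show "eventually (\<lambda>n. r n + 4 \<le> 2 * real n) sequentially"
      using r[unfolded filterlim_at_top, rule_format, of 4] eventually_gt_at_top[of 0]
    proof eventually_elim
      case (elim n)
      have "r n * (L * (\<alpha> - 1)) = r n * (2 * real n * r n powr (1 - \<alpha>))"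
        using r_powr[OF elim(3)] by simp
      also have "\<dots> = 2 * real n * (r n * r n powr (1 - \<alpha>))" by (simp only: mult_ac)
      also have "r n * r n powr (1 - \<alpha>) = r n powr (2 - \<alpha>)"
        using powr_mult_base[of "r n" "1 - \<alpha>"] elim(2) by simp
      also have "2 * real n * r n powr (2 - \<alpha>) \<le> 2 * real n * (L * (\<alpha> - 1) / 2)"
        using elim by (intro mult_left_mono) auto
      finally have "r n * (L * (\<alpha> - 1)) \<le> real n * (L * (\<alpha> - 1))" by simp
      then have "r n \<le> real n" using c by (rule mult_right_le_imp_le)
      then show ?case using elim by simp
    qed
  qed (use \<alpha> k in auto)
qed

text \<open>For \<open>\<alpha> = 2\<close> the longest edge is of the order of the window, and the boundary effect contributes the
  logarithm: the intensity above \<open>x * n\<close> tends to \<open>2 / x - 1 - ln (2 / x)\<close>, which is \<open>ln (h x)\<close>.\<close>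
lemma tail_intensity_tendsto_eq_2:
  assumes x: "0 < x" "x < 2"
    and k: "eventually (\<lambda>n. \<bar>real (k n) - x * real n\<bar> \<le> 4) sequentially"
  shows "(\<lambda>n. tail_intensity 2 n (k n)) \<longlonglongrightarrow> ln (h x)"
proof -
  let ?r = "\<lambda>n. x * real n"
  let ?G = "\<lambda>n t. - (2 * real n / t) - ln t"
  have r: "filterlim ?r at_top sequentially" using x by real_asymp
  show ?thesis
  proof (rule tail_intensity_tendsto[OF r, where G = ?G])
    fix n and t :: real assume "0 < t"
    then show "(?G n has_real_derivative (2 * real n - t) * t powr (- 2)) (at t)"
      by (auto intro!: derivative_eq_intros simp: powr_minus powr_numeral field_simps power2_eq_square)
  next
    fix q assume q: "eventually (\<lambda>n. \<bar>q n - ?r n\<bar> \<le> 5) sequentially"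
    have ratio: "(\<lambda>n. q n / ?r n) \<longlonglongrightarrow> 1" by (rule near_ratio_tendsto_1[OF r q])
    have "(\<lambda>n. -1 + 2 / x / (q n / ?r n) + ln (x / 2 * (q n / ?r n))) \<longlonglongrightarrow> -1 + 2 / x / 1 + ln (x / 2 * 1)"
      using x by (intro tendsto_intros ratio) auto
    moreover have "-1 + 2 / x / 1 + ln (x / 2 * 1) = ln (h x)"
    proof -
      have "ln (h x) = ln (x / 2) + (2 - x) / x"
        unfolding h_def using x by (subst ln_mult) auto
      then show ?thesis using x by (simp add: diff_divide_distrib)
    qed
    moreover have "eventually (\<lambda>n. -1 + 2 / x / (q n / ?r n) + ln (x / 2 * (q n / ?r n)) =
        ?G n (2 * real n) - ?G n (q n)) sequentially"
      using q r[unfolded filterlim_at_top, rule_format, of 6] eventually_gt_at_top[of 0]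
    proof eventually_elim
      case (elim n)
      have "0 < q n" using elim by linarith
      then show ?case using elim x by (simp add: ln_mult ln_div field_simps)
    qed
    ultimately show "(\<lambda>n. ?G n (2 * real n) - ?G n (q n)) \<longlonglongrightarrow> ln (h x)"
      by (simp add: Lim_transform_eventually)
  next
    have "filterlim (\<lambda>n. (2 - x) * real n) at_top sequentially" using x by real_asymp
    then show "eventually (\<lambda>n. x * real n + 4 \<le> 2 * real n) sequentially"
      unfolding filterlim_at_top by (auto elim!: allE[of _ 4] eventually_mono simp: algebra_simps)
  qed (use k in auto)
qed

lemma sum_countdown:
  "k \<le> m \<Longrightarrow> (\<Sum>t\<in>{k..<m}. real m - real t) = (real m - real k) * (real m - real k + 1) / 2"
proof (induction rule: inc_induct)
  case (step k)
  then have "(\<Sum>t\<in>{k..<m}. real m - real t) = (real m - real k) + (\<Sum>t\<in>{Suc k..<m}. real m - real t)"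
    by (simp add: sum.atLeast_Suc_lessThan)
  then show ?case unfolding step.IH by (simp add: field_simps)
qed simp

text \<open>For \<open>\<alpha> < 2\<close> the longest edge falls short of \<open>2 * n\<close> only by the order of
  \<open>(2 * n) powr (\<alpha> / 2)\<close>, which is \<open>o(n)\<close>. On this range \<open>t powr (- \<alpha>)\<close> is asymptotically the
  constant \<open>(2 * n) powr (- \<alpha>)\<close>, and the remaining sum of \<open>2 * n - t\<close> is half the square of the
  gap.\<close>
lemma tail_intensity_tendsto_lt_2:
  assumes \<alpha>: "0 < \<alpha>" "\<alpha> < 2" and c: "0 < c"
    and r: "(\<lambda>n. (2 * real n - r n) / (2 * real n) powr (\<alpha> / 2)) \<longlonglongrightarrow> c"
  shows "filterlim r at_top sequentially"
    and "eventually (\<lambda>n. \<bar>real (k n) - r n\<bar> \<le> 4) sequentially \<Longrightarrow> (\<lambda>n. tail_intensity \<alpha> n (k n)) \<longlonglongrightarrow> c\<^sup>2 / 2"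
    and "eventually (\<lambda>n. \<bar>real (k n) - r n\<bar> \<le> 4) sequentially \<Longrightarrow> (\<lambda>n. tail_degree \<alpha> n (k n)) \<longlonglongrightarrow> 0"
proof -
  define m where "m n = 2 * real n" for n
  have m_pos: "eventually (\<lambda>n. 0 < m n) sequentially"
    using eventually_gt_at_top[of 0] by eventually_elim (simp add: m_def)
  have m_top: "filterlim m at_top sequentially" unfolding m_def by real_asymp
  have m_neg: "(\<lambda>n. m n powr b) \<longlonglongrightarrow> 0" if "b < 0" for b
    using that by (intro tendsto_neg_powr m_top)
  have ratio: "(\<lambda>n. z n / m n) \<longlonglongrightarrow> 1" if z: "(\<lambda>n. (m n - z n) / m n powr (\<alpha> / 2)) \<longlonglongrightarrow> c" for z
  proof -
    have "(\<lambda>n. 1 - (m n - z n) / m n powr (\<alpha> / 2) * m n powr (\<alpha> / 2 - 1)) \<longlonglongrightarrow> 1 - c * 0"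
      using \<alpha> by (intro tendsto_intros z m_neg) simp
    moreover have "eventually (\<lambda>n. 1 - (m n - z n) / m n powr (\<alpha> / 2) * m n powr (\<alpha> / 2 - 1) = z n / m n) sequentially"
      using m_pos
    proof eventually_elim
      case (elim n)
      have "m n powr (\<alpha> / 2 - 1) = m n powr (\<alpha> / 2) / m n"
        using elim by (simp only: powr_diff powr_one)
      then show ?case using elim by (simp add: field_simps)
    qed
    ultimately show ?thesis by (simp add: Lim_transform_eventually)
  qed
  note r' = r[folded m_def]
  have "filterlim (\<lambda>n. r n / m n * m n) at_top sequentially"
    by (rule filterlim_tendsto_pos_mult_at_top[OF ratio[OF r'] _ m_top]) simp
  moreover have "eventually (\<lambda>n. r n / m n * m n = r n) sequentially"
    using m_pos by eventually_elim simp
  ultimately show "filterlim r at_top sequentially"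
    by (simp add: filterlim_cong)
  assume k: "eventually (\<lambda>n. \<bar>real (k n) - r n\<bar> \<le> 4) sequentially"
  \<comment> \<open>the gap in its natural scale\<close>
  define y where "y n = (m n - real (k n)) / m n powr (\<alpha> / 2)" for n
  have y: "y \<longlonglongrightarrow> c"
  proof -
    have "(\<lambda>n. (r n - real (k n)) / m n powr (\<alpha> / 2)) \<longlonglongrightarrow> 0"
    proof (rule Lim_null_comparison)
      have "(\<lambda>n. 4 * m n powr (- (\<alpha> / 2))) \<longlonglongrightarrow> 4 * 0"
        using \<alpha> by (intro tendsto_intros m_neg) simp
      then show "(\<lambda>n. 4 * m n powr (- (\<alpha> / 2))) \<longlonglongrightarrow> 0" by simp
      show "eventually (\<lambda>n. norm ((r n - real (k n)) / m n powr (\<alpha> / 2)) \<le> 4 * m n powr (- (\<alpha> / 2))) sequentially"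
        using k by eventually_elim (auto simp: powr_minus field_simps abs_minus_commute divide_right_mono)
    qed
    from tendsto_add[OF r' this] show ?thesis
      by (simp add: y_def[abs_def] add_divide_distrib[symmetric])
  qed
  have km: "(\<lambda>n. real (k n) / m n) \<longlonglongrightarrow> 1" by (rule ratio) (use y in \<open>simp add: y_def[abs_def]\<close>)
  have "eventually (\<lambda>n. 0 < y n) sequentially" using order_tendstoD(1)[OF y c] .
  moreover have "eventually (\<lambda>n. 0 < real (k n) / m n) sequentially" using order_tendstoD(1)[OF km, of 0] by simp
  ultimately have ev: "eventually (\<lambda>n. 0 < m n \<and> 0 < k n \<and> k n \<le> 2 * n) sequentially"
    using m_pos
  proof eventually_elim
    case (elim n)
    then have "0 < real (k n)" "real (k n) \<le> real (2 * n)"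
      by (auto simp: zero_less_divide_iff y_def m_def)
    then show ?case using elim(3) by simp
  qed
  have pw: "m n powr (- \<alpha>) = m n powr (- (\<alpha> / 2)) * m n powr (- (\<alpha> / 2))" for n
    by (simp add: powr_add[symmetric])
  have K: "m n - real (k n) = y n * m n powr (\<alpha> / 2)" if "0 < m n" for n
    using that by (simp add: y_def)
  have cancel: "m n powr (\<alpha> / 2) * m n powr (- (\<alpha> / 2)) = 1" if "0 < m n" for n
    using that by (simp add: powr_add[symmetric])
  have quad: "(m n - real (k n)) * (m n - real (k n) + 1) / 2 * m n powr (- \<alpha>) = y n * (y n + m n powr (- (\<alpha> / 2))) / 2"
    if "0 < m n" for n
    unfolding K[OF that] pw using cancel[OF that] by algebra
  have count: "(\<Sum>t\<in>{k n..<2 * n}. (2 * real n - real t) * z) = (m n - real (k n)) * (m n - real (k n) + 1) / 2 * z"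
    if "k n \<le> 2 * n" for n z
    using sum_countdown[OF that] by (simp add: sum_distrib_right[symmetric] m_def)
  have kpow: "real (k n) powr (- \<alpha>) = (real (k n) / m n) powr (- \<alpha>) * m n powr (- \<alpha>)"
    if "0 < m n" for n
    using that by (simp add: powr_divide)
  have y_lim: "(\<lambda>n. y n * (y n + m n powr (- (\<alpha> / 2))) / 2) \<longlonglongrightarrow> c * (c + 0) / 2"
    using \<alpha> by (intro tendsto_intros y m_neg) auto
  show "(\<lambda>n. tail_intensity \<alpha> n (k n)) \<longlonglongrightarrow> c\<^sup>2 / 2"
  proof (rule tendsto_sandwich)
    show "(\<lambda>n. y n * (y n + m n powr (- (\<alpha> / 2))) / 2) \<longlonglongrightarrow> c\<^sup>2 / 2"
      using y_lim by (simp add: power2_eq_square)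
    have "(\<lambda>n. y n * (y n + m n powr (- (\<alpha> / 2))) / 2 * (real (k n) / m n) powr (- \<alpha>)) \<longlonglongrightarrow> c * (c + 0) / 2 * 1 powr (- \<alpha>)"
      by (intro tendsto_mult y_lim tendsto_powr km tendsto_const) simp
    then show "(\<lambda>n. y n * (y n + m n powr (- (\<alpha> / 2))) / 2 * (real (k n) / m n) powr (- \<alpha>)) \<longlonglongrightarrow> c\<^sup>2 / 2"
      by (simp add: power2_eq_square)
    show "eventually (\<lambda>n. y n * (y n + m n powr (- (\<alpha> / 2))) / 2 \<le> tail_intensity \<alpha> n (k n)) sequentially"
      using ev
    proof eventually_elim
      case (elim n)
      have "y n * (y n + m n powr (- (\<alpha> / 2))) / 2 = (\<Sum>t\<in>{k n..<2 * n}. (2 * real n - real t) * m n powr (- \<alpha>))"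
        using elim by (simp only: count quad)
      also have "\<dots> \<le> tail_intensity \<alpha> n (k n)"
        unfolding tail_intensity_def using elim \<alpha>
        by (intro sum_mono mult_left_mono powr_mono2') (auto simp: m_def)
      finally show ?case .
    qed
    show "eventually (\<lambda>n. tail_intensity \<alpha> n (k n) \<le>
        y n * (y n + m n powr (- (\<alpha> / 2))) / 2 * (real (k n) / m n) powr (- \<alpha>)) sequentially"
      using ev
    proof eventually_elim
      case (elim n)
      have "tail_intensity \<alpha> n (k n) \<le> (\<Sum>t\<in>{k n..<2 * n}. (2 * real n - real t) * real (k n) powr (- \<alpha>))"
        unfolding tail_intensity_def using elim \<alpha>
        by (intro sum_mono mult_left_mono powr_mono2') auto
      also have "\<dots> = y n * (y n + m n powr (- (\<alpha> / 2))) / 2 * (real (k n) / m n) powr (- \<alpha>)"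
        using elim unfolding count[OF conjunct2[OF conjunct2[OF elim]]] kpow[OF conjunct1[OF elim]]
          quad[OF conjunct1[OF elim], symmetric] by (simp only: mult_ac)
      finally show ?case .
    qed
  qed
  show "(\<lambda>n. tail_degree \<alpha> n (k n)) \<longlonglongrightarrow> 0"
  proof (rule tendsto_sandwich[where f = "\<lambda>_. 0"])
    have "(\<lambda>n. y n * m n powr (- (\<alpha> / 2)) * (real (k n) / m n) powr (- \<alpha>)) \<longlonglongrightarrow> c * 0 * 1 powr (- \<alpha>)"
      using \<alpha> by (intro tendsto_mult y m_neg tendsto_powr km tendsto_const) auto
    then show "(\<lambda>n. y n * m n powr (- (\<alpha> / 2)) * (real (k n) / m n) powr (- \<alpha>)) \<longlonglongrightarrow> 0" by simp
    show "eventually (\<lambda>n. tail_degree \<alpha> n (k n) \<le> y n * m n powr (- (\<alpha> / 2)) * (real (k n) / m n) powr (- \<alpha>)) sequentially"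
      using ev
    proof eventually_elim
      case (elim n)
      have "tail_degree \<alpha> n (k n) \<le> (\<Sum>t\<in>{k n..<2 * n}. real (k n) powr (- \<alpha>))"
        unfolding tail_degree_def using elim \<alpha> by (intro sum_mono powr_mono2') auto
      also have "\<dots> = (m n - real (k n)) * real (k n) powr (- \<alpha>)"
        using elim by (simp add: m_def of_nat_diff)
      also have "\<dots> = y n * m n powr (- (\<alpha> / 2)) * (real (k n) / m n) powr (- \<alpha>)"
        using elim cancel[of n] unfolding kpow[OF conjunct1[OF elim]] K[OF conjunct1[OF elim]] pw by algebra
      finally show ?case .
    qed
  qed (auto simp: tail_degree_nonneg)
qed

section \<open>Uniform limits of transformed longest edges\<close>

lemma weak_conv_uniformI:
  fixes X :: "nat \<Rightarrow> 'a \<Rightarrow> real"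
  assumes M: "prob_space M" and X: "\<And>n. X n \<in> borel_measurable M"
    and bounds: "eventually (\<lambda>n. \<forall>\<omega>\<in>space M. 0 \<le> X n \<omega> \<and> X n \<omega> \<le> 1) sequentially"
    and lim: "\<And>u. 0 < u \<Longrightarrow> u < 1 \<Longrightarrow> (\<lambda>n. measure M {\<omega> \<in> space M. X n \<omega> \<le> u}) \<longlonglongrightarrow> u"
  shows "weak_conv_m (\<lambda>n. distr M borel (X n)) (uniform_measure lborel {0<..<1})"
proof -
  interpret prob_space M by fact
  have cdf_X: "cdf (distr M borel (X n)) x = prob {\<omega> \<in> space M. X n \<omega> \<le> x}" for n x
    unfolding cdf_def2 by (subst measure_distr[OF X]) (auto intro!: arg_cong[of _ _ prob])
  have cdf_U: "cdf (uniform_measure lborel {0<..<1}) x = max 0 (min x 1)" for x :: real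
  proof -
    have "{0<..<1} \<inter> {..x} = (if x < 1 then {0<..x} else {0<..<1})" by auto
    then show ?thesis unfolding cdf_def2
      by (subst measure_uniform_measure) (cases "0 \<le> x"; auto)+
  qed
  have "(\<lambda>n. prob {\<omega> \<in> space M. X n \<omega> \<le> x}) \<longlonglongrightarrow> max 0 (min x 1)" for x
  proof -
    consider "x < 0" | "x = 0" | "0 < x" "x < 1" | "1 \<le> x" by linarith
    then show ?thesis
    proof cases
      case 1
      have "eventually (\<lambda>n. prob {\<omega> \<in> space M. X n \<omega> \<le> x} = 0) sequentially"
        using bounds
      proof eventually_elim
        case (elim n)
        then have "{\<omega> \<in> space M. X n \<omega> \<le> x} = {}" using 1 by force
        then show ?case by (simp only: measure_empty)
      qed
      then show ?thesis using 1 by (simp add: tendsto_eventually)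
    next
      \<comment> \<open>at 0 the distribution functions are squeezed by their values at small positive arguments\<close>
      case 2
      show ?thesis
      proof (rule order_tendstoI)
        fix c :: real assume "c < max 0 (min x 1)"
        then have "c < 0" using 2 by simp
        then show "eventually (\<lambda>n. c < prob {\<omega> \<in> space M. X n \<omega> \<le> x}) sequentially"
          by (intro always_eventually allI) (rule less_le_trans, auto)
      next
        fix c :: real assume "max 0 (min x 1) < c"
        then have c: "0 < min (c / 2) (1 / 2)" "min (c / 2) (1 / 2) < 1" "min (c / 2) (1 / 2) < c" using 2 by auto
        from order_tendstoD(2)[OF lim[OF c(1,2)] c(3)]
        show "eventually (\<lambda>n. prob {\<omega> \<in> space M. X n \<omega> \<le> x} < c) sequentially"
        proof eventually_elim
          case (elim n)
          have "prob {\<omega> \<in> space M. X n \<omega> \<le> x} \<le> prob {\<omega> \<in> space M. X n \<omega> \<le> min (c / 2) (1 / 2)}"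
            using c 2 X[of n] by (intro finite_measure_mono) auto
          then show ?case using elim by simp
        qed
      qed
    next
      case 3 then show ?thesis using lim[of x] by simp
    next
      case 4
      have "eventually (\<lambda>n. prob {\<omega> \<in> space M. X n \<omega> \<le> x} = 1) sequentially"
        using bounds
      proof eventually_elim
        case (elim n)
        then have "{\<omega> \<in> space M. X n \<omega> \<le> x} = space M" using 4 by force
        then show ?case by (simp only: prob_space)
      qed
      then show ?thesis using 4 by (simp add: tendsto_eventually)
    qed
  qed
  then show ?thesis unfolding weak_conv_m_def weak_conv_def cdf_X cdf_U by blast
qed

context poisson_random_graph
begin

lemma edges_finite: "\<omega> \<in> space M \<Longrightarrow> finite (E \<omega>)"
  and edges_pairs: "\<omega> \<in> space M \<Longrightarrow> E \<omega> \<subseteq> unordered_pairs UNIV"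
  and longest_edge_range: "\<omega> \<in> space M \<Longrightarrow> 0 \<le> longest_edge (E \<omega>) \<and> longest_edge (E \<omega>) \<le> 2 * real n"
  and longest_edge_eq_0: "\<omega> \<in> space M \<Longrightarrow> longest_edge (E \<omega>) = 0 \<longleftrightarrow> E \<omega> = {}"
proof -
  assume "\<omega> \<in> space M"
  then have Q: "finite (P \<omega> \<inter> {- real n..real n})" and sub: "E \<omega> \<subseteq> unordered_pairs (P \<omega> \<inter> {- real n..real n})"
    using E unfolding soft_random_graph_def by auto
  show "finite (E \<omega>)" using finite_subset[OF sub finite_unordered_pairs[OF Q]] .
  show "E \<omega> \<subseteq> unordered_pairs UNIV" using sub unordered_pairs_UNIV by (rule subset_trans)
  note b = longest_edge_bounds[OF Q _ sub]
  show "0 \<le> longest_edge (E \<omega>) \<and> longest_edge (E \<omega>) \<le> 2 * real n"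
    using b[of "real n"] by (cases "E \<omega> = {}") (auto simp: longest_edge_def)
  show "longest_edge (E \<omega>) = 0 \<longleftrightarrow> E \<omega> = {}"
    using b(1)[of "real n"] by (cases "E \<omega> = {}") (auto simp: longest_edge_def)
qed

lemma longest_edge_le_iff_short:
  "\<omega> \<in> space M \<Longrightarrow> 0 \<le> r \<Longrightarrow> longest_edge (E \<omega>) \<le> r \<longleftrightarrow> E \<omega> \<in> short_edge_sets r"
  by (rule longest_edge_le_iff[OF edges_finite edges_pairs])

lemma longest_edge_measurable: "(\<lambda>\<omega>. longest_edge (E \<omega>)) \<in> borel_measurable M"
  unfolding borel_measurable_iff_le
proof
  fix r
  have EM: "E \<in> M \<rightarrow>\<^sub>M edge_configs" using E by (simp add: soft_random_graph_def)
  show "{\<omega> \<in> space M. longest_edge (E \<omega>) \<le> r} \<in> sets M"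
  proof (cases "0 \<le> r")
    case True
    then have "{\<omega> \<in> space M. longest_edge (E \<omega>) \<le> r} = E -` short_edge_sets r \<inter> space M"
      using longest_edge_le_iff_short by auto
    then show ?thesis using measurable_sets[OF EM short_edge_sets_measurable] by simp
  next
    case False
    then have "{\<omega> \<in> space M. longest_edge (E \<omega>) \<le> r} = {}" using longest_edge_range by force
    then show ?thesis by (simp only: sets.empty_sets)
  qed
qed

end

text \<open>If \<open>T n\<close> crosses the level \<open>u\<close> at \<open>r n\<close>, then the transformed longest edge is at most \<open>u\<close> exactly when
  there is no edge longer than \<open>r n\<close>. The limiting intensity \<open>- ln u\<close> is the one that gives this event
  the probability \<open>exp (- (- ln u)) = u\<close>.\<close>
lemma weak_conv_transformed_longest_edge:
  fixes g :: "real \<Rightarrow> real" and E :: "nat \<Rightarrow> 'a \<Rightarrow> real set set" and T :: "nat \<Rightarrow> real \<Rightarrow> real"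
  assumes graph: "\<And>n. poisson_random_graph M P g n (E n)"
    and lim: "((\<lambda>x. g x / \<bar>x\<bar> powr (- \<alpha>)) \<longlongrightarrow> 1) at_infinity" and \<alpha>: "0 < \<alpha>"
    and T: "\<And>n. T n \<in> borel_measurable borel"
    and T_range: "\<And>n y. 0 < n \<Longrightarrow> 0 \<le> y \<Longrightarrow> y \<le> 2 * real n \<Longrightarrow> 0 \<le> T n y \<and> T n y \<le> 1"
    and threshold: "\<And>u. 0 < u \<Longrightarrow> u < 1 \<Longrightarrow> \<exists>r. filterlim r at_top sequentially \<and>
      eventually (\<lambda>n. \<forall>y. 0 \<le> y \<and> y \<le> 2 * real n \<longrightarrow> (T n y \<le> u \<longleftrightarrow> y \<le> r n)) sequentially \<and>
      (\<forall>k. eventually (\<lambda>n. \<bar>real (k n) - r n\<bar> \<le> 4) sequentially \<longrightarrow>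
        (\<lambda>n. tail_intensity \<alpha> n (k n)) \<longlonglongrightarrow> - ln u \<and> (\<lambda>n. tail_degree \<alpha> n (k n)) \<longlonglongrightarrow> 0)"
    and X: "\<And>n \<omega>. \<omega> \<in> space M \<Longrightarrow> X n \<omega> = T n (longest_edge (E n \<omega>))"
  shows "weak_conv_m (\<lambda>n. distr M borel (X n)) (uniform_measure lborel {0<..<1})"
proof (rule weak_conv_uniformI)
  show "prob_space M" using graph[of 0] by (simp add: poisson_random_graph_def)
  have range: "0 \<le> longest_edge (E n \<omega>) \<and> longest_edge (E n \<omega>) \<le> 2 * real n" if "\<omega> \<in> space M" for n \<omega>
    using poisson_random_graph.longest_edge_range[OF graph that] .
  have "(\<lambda>\<omega>. T n (longest_edge (E n \<omega>))) \<in> borel_measurable M" for n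
    using measurable_compose[OF poisson_random_graph.longest_edge_measurable[OF graph] T] .
  then show "X n \<in> borel_measurable M" for n
    using X by (subst measurable_cong[of M "X n"]) auto
  show "eventually (\<lambda>n. \<forall>\<omega>\<in>space M. 0 \<le> X n \<omega> \<and> X n \<omega> \<le> 1) sequentially"
    using eventually_gt_at_top[of 0] by eventually_elim (use X T_range range in simp)
next
  fix u :: real assume u: "0 < u" "u < 1"
  from threshold[OF this] obtain r where r: "filterlim r at_top sequentially"
    and Tr: "eventually (\<lambda>n. \<forall>y. 0 \<le> y \<and> y \<le> 2 * real n \<longrightarrow> (T n y \<le> u \<longleftrightarrow> y \<le> r n)) sequentially"
    and S: "\<And>k. eventually (\<lambda>n. \<bar>real (k n) - r n\<bar> \<le> 4) sequentially \<Longrightarrow>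
        (\<lambda>n. tail_intensity \<alpha> n (k n)) \<longlonglongrightarrow> - ln u \<and> (\<lambda>n. tail_degree \<alpha> n (k n)) \<longlonglongrightarrow> 0"
    by blast
  have "(\<lambda>n. measure M {\<omega> \<in> space M. E n \<omega> \<in> short_edge_sets (r n)}) \<longlonglongrightarrow> exp (- (- ln u))"
    by (rule prob_no_long_edge_tendsto[OF graph lim \<alpha> r S])
  moreover have "eventually (\<lambda>n. measure M {\<omega> \<in> space M. E n \<omega> \<in> short_edge_sets (r n)} =
      measure M {\<omega> \<in> space M. X n \<omega> \<le> u}) sequentially"
    using Tr r[unfolded filterlim_at_top, rule_format, of 0]
  proof eventually_elim
    case (elim n)
    have "E n \<omega> \<in> short_edge_sets (r n) \<longleftrightarrow> X n \<omega> \<le> u" if "\<omega> \<in> space M" for \<omega>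
      using poisson_random_graph.longest_edge_le_iff_short[OF graph that elim(2), of n]
        elim(1) poisson_random_graph.longest_edge_range[OF graph that, of n] X[OF that] by auto
    then show ?case by (intro arg_cong[of _ _ "measure M"]) auto
  qed
  ultimately show "(\<lambda>n. measure M {\<omega> \<in> space M. X n \<omega> \<le> u}) \<longlonglongrightarrow> u"
    using u by (simp add: Lim_transform_eventually)
qed

section \<open>Thresholds of the transformations\<close>

text \<open>A threshold of the form \<open>2 * n * \<phi> (q n)\<close> with \<open>\<phi> q = 1 - q + o(q)\<close>. The scale of \<open>q n\<close> is the one at
  which the gap to \<open>2 * n\<close> has the order \<open>(2 * n) powr (\<alpha> / 2)\<close>.\<close>
lemma gap_below_window_tendsto:
  fixes \<phi> :: "real \<Rightarrow> real"
  assumes \<phi>: "((\<lambda>q. (1 - \<phi> q) / q) \<longlongrightarrow> 1) (at_right 0)" and c: "0 < c" and \<alpha>: "\<alpha> < 2"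
  defines "q \<equiv> \<lambda>n. c * (2 * real n) powr (\<alpha> / 2 - 1)"
  shows "filterlim q (at_right 0) sequentially"
    and "(\<lambda>n. (2 * real n - 2 * real n * \<phi> (q n)) / (2 * real n) powr (\<alpha> / 2)) \<longlonglongrightarrow> c"
proof -
  have "filterlim (\<lambda>n. 2 * real n) at_top sequentially" by real_asymp
  then have "(\<lambda>n. c * (2 * real n) powr (\<alpha> / 2 - 1)) \<longlonglongrightarrow> c * 0"
    using \<alpha> by (intro tendsto_intros tendsto_neg_powr) auto
  then have "q \<longlonglongrightarrow> 0" by (simp add: q_def)
  moreover have q_pos: "eventually (\<lambda>n. 0 < q n) sequentially"
    using eventually_gt_at_top[of 0] by eventually_elim (use c in \<open>simp add: q_def\<close>)
  ultimately show q: "filterlim q (at_right 0) sequentially"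
    by (rule tendsto_imp_filterlim_at_right)
  have "(\<lambda>n. c * ((1 - \<phi> (q n)) / q n)) \<longlonglongrightarrow> c * 1"
    by (intro tendsto_intros filterlim_compose[OF \<phi> q])
  moreover have "eventually (\<lambda>n. c * ((1 - \<phi> (q n)) / q n) =
      (2 * real n - 2 * real n * \<phi> (q n)) / (2 * real n) powr (\<alpha> / 2)) sequentially"
    using eventually_gt_at_top[of 0]
  proof eventually_elim
    case (elim n)
    define m where "m = 2 * real n"
    have "0 < m" using elim by (simp add: m_def)
    moreover have "m powr (\<alpha> / 2 - 1) = m powr (\<alpha> / 2) / m"
      using \<open>0 < m\<close> by (simp only: powr_diff powr_one)
    ultimately show ?case
      using c unfolding q_def m_def[symmetric] by (simp add: field_simps)
  qed
  ultimately show "(\<lambda>n. (2 * real n - 2 * real n * \<phi> (q n)) / (2 * real n) powr (\<alpha> / 2)) \<longlonglongrightarrow> c"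
    by (simp add: Lim_transform_eventually)
qed

text \<open>The transformations for \<open>1 < \<alpha> < 2\<close> and for \<open>\<alpha> < 1\<close> are the cases \<open>\<beta> = 2 - \<alpha>\<close> and \<open>\<beta> = 1 - \<alpha>\<close> of a
  single family: since \<open>(2 * n) powr \<beta> - y powr \<beta>\<close> is asymptotically
  \<open>\<beta> * (2 * n) powr (\<beta> - 1) * (2 * n - y)\<close>, the exponent is \<open>(2 * n) powr (- \<alpha>) / 2\<close> times the
  squared gap whatever the value of \<open>\<beta>\<close>.\<close>
lemma threshold_powr:
  fixes \<alpha> \<beta> u :: real
  assumes \<alpha>: "0 < \<alpha>" "\<alpha> < 2" and \<beta>: "0 < \<beta>" and u: "0 < u" "u < 1"
  shows "\<exists>r. filterlim r at_top sequentially \<and>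
    eventually (\<lambda>n. \<forall>y. 0 \<le> y \<and> y \<le> 2 * real n \<longrightarrow>
      (exp (- ((2 * real n) powr (2 - \<alpha> - 2 * \<beta>) * inverse 2 * \<beta> powr (-2) *
        (y powr \<beta> - (2 * real n) powr \<beta>)\<^sup>2)) \<le> u \<longleftrightarrow> y \<le> r n)) sequentially \<and>
    (\<forall>k. eventually (\<lambda>n. \<bar>real (k n) - r n\<bar> \<le> 4) sequentially \<longrightarrow>
      (\<lambda>n. tail_intensity \<alpha> n (k n)) \<longlonglongrightarrow> - ln u \<and> (\<lambda>n. tail_degree \<alpha> n (k n)) \<longlonglongrightarrow> 0)"
proof -
  define c where "c = sqrt (2 * (- ln u))"
  have c: "0 < c" "c\<^sup>2 / 2 = - ln u" using u by (auto simp: c_def)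
  define q where "q n = c * (2 * real n) powr (\<alpha> / 2 - 1)" for n
  define \<phi> where "\<phi> x = (1 - \<beta> * x) powr (1 / \<beta>)" for x
  define r where "r n = 2 * real n * \<phi> (q n)" for n
  have "((\<lambda>x. (1 - \<phi> x) / x) \<longlongrightarrow> 1) (at_right 0)"
    unfolding \<phi>_def using \<beta> by real_asymp
  note gap = gap_below_window_tendsto[OF this c(1) \<alpha>(2), folded q_def, folded r_def]
  note lims = tail_intensity_tendsto_lt_2[OF \<alpha> c(1) gap(2), unfolded c(2)]
  have "eventually (\<lambda>x. x \<in> {0<..<1 / \<beta>}) (at_right 0)"
    using \<beta> by (intro eventually_at_right_real) simp
  then have "eventually (\<lambda>n. q n \<in> {0<..<1 / \<beta>}) sequentially"
    using gap(1) unfolding filterlim_iff by blast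
  then have "eventually (\<lambda>n. \<forall>y. 0 \<le> y \<and> y \<le> 2 * real n \<longrightarrow>
      (exp (- ((2 * real n) powr (2 - \<alpha> - 2 * \<beta>) * inverse 2 * \<beta> powr (-2) *
        (y powr \<beta> - (2 * real n) powr \<beta>)\<^sup>2)) \<le> u \<longleftrightarrow> y \<le> r n)) sequentially"
    using eventually_gt_at_top[of 0]
  proof (eventually_elim, intro allI impI)
    fix n y assume q: "q n \<in> {0<..<1 / \<beta>}" and n: "0 < n" and y: "0 \<le> y \<and> y \<le> 2 * real n"
    define m where "m = 2 * real n"
    define A where "A = m powr (2 - \<alpha> - 2 * \<beta>) * inverse 2 * \<beta> powr (-2)"
    have m: "0 < m" using n by (simp add: m_def)
    have A: "0 < A" using m \<beta> by (simp add: A_def)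
    have q01: "0 < q n" "0 < 1 - \<beta> * q n" using q \<beta> by (auto simp: field_simps)
    have r0: "0 \<le> r n" by (simp add: r_def \<phi>_def)
    have r_powr: "r n powr \<beta> = m powr \<beta> * (1 - \<beta> * q n)"
      using m \<beta> q01 by (simp add: r_def \<phi>_def m_def[symmetric] powr_mult powr_powr)
    then have r_gap: "m powr \<beta> - r n powr \<beta> = m powr \<beta> * \<beta> * q n" by (simp add: algebra_simps)
    have at_r: "A * (m powr \<beta> - r n powr \<beta>)\<^sup>2 = - ln u"
    proof -
      have "A * (m powr \<beta> - r n powr \<beta>)\<^sup>2 =
          (m powr (2 - \<alpha> - 2 * \<beta>) * (m powr \<beta>)\<^sup>2 * (m powr (\<alpha> / 2 - 1))\<^sup>2) * (c\<^sup>2 / 2) * (\<beta> powr (-2) * \<beta>\<^sup>2)"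
        unfolding r_gap A_def q_def m_def[symmetric] by (simp add: power_mult_distrib)
      also have "\<beta> powr (-2) * \<beta>\<^sup>2 = 1"
        using \<beta> by (simp add: powr_minus powr_numeral)
      also have "m powr (2 - \<alpha> - 2 * \<beta>) * (m powr \<beta>)\<^sup>2 * (m powr (\<alpha> / 2 - 1))\<^sup>2 = 1"
        using m by (simp add: power2_eq_square powr_add[symmetric])
      finally show ?thesis using c(2) by simp
    qed
    have gap0: "0 \<le> m powr \<beta> - y powr \<beta>" "0 \<le> m powr \<beta> - r n powr \<beta>"
      using y \<beta> m q01 unfolding r_gap by (auto simp: m_def intro!: powr_mono2)
    have "exp (- (A * (y powr \<beta> - m powr \<beta>)\<^sup>2)) \<le> u \<longleftrightarrow> - (A * (y powr \<beta> - m powr \<beta>)\<^sup>2) \<le> ln u"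
      using u(1) by (metis exp_le_cancel_iff exp_ln)
    also have "\<dots> \<longleftrightarrow> A * (m powr \<beta> - r n powr \<beta>)\<^sup>2 \<le> A * (m powr \<beta> - y powr \<beta>)\<^sup>2"
      unfolding at_r by (simp add: power2_commute[of "y powr \<beta>"] minus_le_iff)
    also have "\<dots> \<longleftrightarrow> m powr \<beta> - r n powr \<beta> \<le> m powr \<beta> - y powr \<beta>"
      using A gap0 by (simp add: power2_le_iff_abs_le)
    also have "\<dots> \<longleftrightarrow> y \<le> r n"
      using powr_mono2[of \<beta> y "r n"] powr_less_mono2[of \<beta> "r n" y] y r0 \<beta> by (auto simp: not_le[symmetric])
    finally show "exp (- ((2 * real n) powr (2 - \<alpha> - 2 * \<beta>) * inverse 2 * \<beta> powr (-2) *
        (y powr \<beta> - (2 * real n) powr \<beta>)\<^sup>2)) \<le> u \<longleftrightarrow> y \<le> r n"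
      unfolding A_def m_def .
  qed
  then show ?thesis using lims by blast
qed

text \<open>The limit of the preceding family as \<open>\<beta>\<close> tends to 0: the logarithm replaces the power.\<close>
lemma threshold_ln:
  assumes u: "0 < u" "u < 1"
  shows "\<exists>r. filterlim r at_top sequentially \<and>
    eventually (\<lambda>n. \<forall>y. 0 \<le> y \<and> y \<le> 2 * real n \<longrightarrow>
      ((if y = 0 then 0 else exp (- (real n * (ln (y / (2 * real n)))\<^sup>2))) \<le> u \<longleftrightarrow> y \<le> r n)) sequentially \<and>
    (\<forall>k. eventually (\<lambda>n. \<bar>real (k n) - r n\<bar> \<le> 4) sequentially \<longrightarrow>
      (\<lambda>n. tail_intensity 1 n (k n)) \<longlonglongrightarrow> - ln u \<and> (\<lambda>n. tail_degree 1 n (k n)) \<longlonglongrightarrow> 0)"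
proof -
  define c where "c = sqrt (2 * (- ln u))"
  have c: "0 < c" "c\<^sup>2 / 2 = - ln u" using u by (auto simp: c_def)
  define q where "q n = c * (2 * real n) powr (1 / 2 - 1)" for n
  define r where "r n = 2 * real n * exp (- q n)" for n
  have "((\<lambda>x :: real. (1 - exp (- x)) / x) \<longlongrightarrow> 1) (at_right 0)" by real_asymp
  moreover have "(0 :: real) < 1" "(1 :: real) < 2" by simp_all
  ultimately have gap: "(\<lambda>n. (2 * real n - r n) / (2 * real n) powr (1 / 2)) \<longlonglongrightarrow> c"
    unfolding r_def q_def using c(1) by (intro gap_below_window_tendsto(2))
  note lims = tail_intensity_tendsto_lt_2[OF \<open>0 < 1\<close> \<open>1 < 2\<close> c(1) gap, unfolded c(2)]
  have "eventually (\<lambda>n. \<forall>y. 0 \<le> y \<and> y \<le> 2 * real n \<longrightarrow>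
      ((if y = 0 then 0 else exp (- (real n * (ln (y / (2 * real n)))\<^sup>2))) \<le> u \<longleftrightarrow> y \<le> r n)) sequentially"
    using eventually_gt_at_top[of 0]
  proof (eventually_elim, intro allI impI)
    fix n y assume n: "0 < (n :: nat)" and y: "0 \<le> y \<and> y \<le> 2 * real n"
    show "(if y = 0 then 0 else exp (- (real n * (ln (y / (2 * real n)))\<^sup>2))) \<le> u \<longleftrightarrow> y \<le> r n"
    proof (cases "y = 0")
      case True then show ?thesis using u by (simp add: r_def)
    next
      case False
      define l where "l = ln (y / (2 * real n))"
      have l: "l \<le> 0" using False y n by (simp add: l_def ln_le_zero_iff)
      have q0: "0 \<le> q n" using c by (simp add: q_def)
      have "real n * (q n)\<^sup>2 = - ln u"
      proof -
        have "((2 * real n) powr (1 / 2 - 1))\<^sup>2 = inverse (2 * real n)"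
          using n unfolding power2_eq_square powr_add[symmetric] by (simp add: powr_minus)
        then show ?thesis using n c(2) by (simp add: q_def power_mult_distrib field_simps)
      qed
      have "exp (- (real n * l\<^sup>2)) \<le> u \<longleftrightarrow> - (real n * l\<^sup>2) \<le> ln u"
        using u(1) by (metis exp_le_cancel_iff exp_ln)
      also have "\<dots> \<longleftrightarrow> real n * (q n)\<^sup>2 \<le> real n * l\<^sup>2"
        unfolding \<open>real n * (q n)\<^sup>2 = - ln u\<close> by (simp add: minus_le_iff)
      also have "\<dots> \<longleftrightarrow> l \<le> - q n"
        using n l q0 by (simp add: power2_le_iff_abs_le abs_le_iff[symmetric] flip: abs_le_square_iff) linarith
      also have "\<dots> \<longleftrightarrow> y / (2 * real n) \<le> exp (- q n)"
        unfolding l_def using False y n by (metis divide_pos_pos exp_ln_iff exp_le_cancel_iff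
          less_le mult_pos_pos of_nat_0_less_iff zero_less_numeral)
      also have "\<dots> \<longleftrightarrow> y \<le> r n" using n by (simp add: r_def field_simps)
      finally show ?thesis using False by (simp add: l_def)
    qed
  qed
  then show ?thesis using lims by blast
qed

lemma threshold_gt_2:
  assumes \<alpha>: "2 < \<alpha>" and u: "0 < u" "u < 1"
  shows "\<exists>r. filterlim r at_top sequentially \<and>
    eventually (\<lambda>n. \<forall>y. 0 \<le> y \<and> y \<le> 2 * real n \<longrightarrow>
      ((if y = 0 then 0 else exp (2 * real n / (1 - \<alpha>) * y powr (1 - \<alpha>))) \<le> u \<longleftrightarrow> y \<le> r n)) sequentially \<and>
    (\<forall>k. eventually (\<lambda>n. \<bar>real (k n) - r n\<bar> \<le> 4) sequentially \<longrightarrow>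
      (\<lambda>n. tail_intensity \<alpha> n (k n)) \<longlonglongrightarrow> - ln u \<and> (\<lambda>n. tail_degree \<alpha> n (k n)) \<longlonglongrightarrow> 0)"
proof -
  define L where "L = - ln u"
  have L: "0 < L" using u by (simp add: L_def)
  define r where "r n = (L * (\<alpha> - 1) / (2 * real n)) powr (1 / (1 - \<alpha>))" for n
  have top: "filterlim r at_top sequentially"
    unfolding r_def[abs_def] by (rule tail_intensity_tendsto_gt_2(1)[OF \<alpha> L])
  have "eventually (\<lambda>n. \<forall>y. 0 \<le> y \<and> y \<le> 2 * real n \<longrightarrow>
      ((if y = 0 then 0 else exp (2 * real n / (1 - \<alpha>) * y powr (1 - \<alpha>))) \<le> u \<longleftrightarrow> y \<le> r n)) sequentially"
    using eventually_gt_at_top[of 0]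
  proof (eventually_elim, intro allI impI)
    fix n y assume n: "0 < (n :: nat)" and y: "0 \<le> y \<and> y \<le> 2 * real n"
    show "(if y = 0 then 0 else exp (2 * real n / (1 - \<alpha>) * y powr (1 - \<alpha>))) \<le> u \<longleftrightarrow> y \<le> r n"
    proof (cases "y = 0")
      case True then show ?thesis using u by (simp add: r_def)
    next
      case False
      have c: "0 < L * (\<alpha> - 1)" using \<alpha> L by simp
      have r0: "0 < r n" using \<alpha> L n by (simp add: r_def)
      have r_powr: "r n powr (1 - \<alpha>) = L * (\<alpha> - 1) / (2 * real n)"
        using \<alpha> L n by (simp add: r_def powr_powr)
      have "exp (2 * real n / (1 - \<alpha>) * y powr (1 - \<alpha>)) \<le> u \<longleftrightarrow> 2 * real n / (1 - \<alpha>) * y powr (1 - \<alpha>) \<le> - L"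
        using u(1) unfolding L_def by (metis exp_le_cancel_iff exp_ln minus_minus)
      also have "\<dots> \<longleftrightarrow> r n powr (1 - \<alpha>) \<le> y powr (1 - \<alpha>)"
        unfolding r_powr using \<alpha> n by (simp add: field_simps)
      also have "\<dots> \<longleftrightarrow> y \<le> r n"
        using powr_less_mono2_neg[of "1 - \<alpha>" "r n" y] powr_mono2'[of "1 - \<alpha>" y "r n"] \<alpha> r0 y False
        by force
      finally show ?thesis using False by simp
    qed
  qed
  moreover have "(\<lambda>n. tail_intensity \<alpha> n (k n)) \<longlonglongrightarrow> - ln u \<and> (\<lambda>n. tail_degree \<alpha> n (k n)) \<longlonglongrightarrow> 0"
    if k: "eventually (\<lambda>n. \<bar>real (k n) - r n\<bar> \<le> 4) sequentially" for k
    using tail_intensity_tendsto_gt_2(2)[OF \<alpha> L, folded r_def, OF k] \<alpha>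
      tail_degree_tendsto_0[OF near_filterlim_at_top[OF top k]] unfolding L_def by simp
  ultimately show ?thesis using top by blast
qed

text \<open>The difference \<open>ln (h x) - ln (h y)\<close> equals \<open>(2 / x - 2 / y) - ln (y / x)\<close>, and the strict inequality
  \<open>ln z < z - 1\<close> for \<open>z > 1\<close> together with \<open>y \<le> 2\<close> makes it positive.\<close>
lemma h_strict_antimono: "0 < x \<Longrightarrow> x < y \<Longrightarrow> y \<le> 2 \<Longrightarrow> h y < h x"
proof -
  assume xy: "0 < x" "x < y" "y \<le> 2"
  have "1 < y / x" using xy by simp
  then have "ln (1 + (y / x - 1)) < y / x - 1" by (intro ln_add_one_self_less_self) simp
  then have "ln y - ln x < (y - x) / x * 1" using xy by (simp add: ln_div diff_divide_distrib)
  also have "(y - x) / x * 1 \<le> (y - x) / x * (2 / y)" using xy by (intro mult_left_mono) auto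
  also have "\<dots> = 2 / x - 2 / y" using xy by (simp add: field_simps)
  finally have "ln (h y) < ln (h x)"
    using xy by (simp add: h_def ln_mult ln_div diff_divide_distrib)
  then show ?thesis using xy by (simp add: h_def)
qed

lemma h_ge_1: "0 < x \<Longrightarrow> x \<le> 2 \<Longrightarrow> 1 \<le> h x"
  using h_strict_antimono[of x 2] by (cases "x = 2") (auto simp: h_def)

lemma h_surj:
  assumes "1 < v" obtains x where "0 < x" "x < 2" "h x = v"
proof -
  have "filterlim h at_top (at_right 0)" unfolding h_def by real_asymp
  then have "eventually (\<lambda>x. v \<le> h x) (at_right 0)" by (auto simp: filterlim_at_top)
  moreover have "eventually (\<lambda>x :: real. x \<in> {0<..<2}) (at_right 0)" by (intro eventually_at_right_real) simp
  ultimately have "eventually (\<lambda>x. v \<le> h x \<and> x \<in> {0<..<2}) (at_right 0)" by (rule eventually_conj)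
  then obtain a where a: "v \<le> h a" "0 < a" "a < 2"
    using eventually_happens'[OF trivial_limit_at_right_real] by auto
  have "\<exists>x\<ge>a. x \<le> 2 \<and> h x = v"
  proof (rule IVT2')
    show "continuous_on {a..2} h" unfolding h_def using a by (intro continuous_intros) auto
  qed (use a assms in \<open>auto simp: h_def\<close>)
  then obtain x where "a \<le> x" "x \<le> 2" "h x = v" by blast
  moreover have "x \<noteq> 2" using \<open>h x = v\<close> assms by (auto simp: h_def)
  ultimately show ?thesis using a by (intro that[of x]) auto
qed

lemma threshold_eq_2:
  assumes u: "0 < u" "u < 1"
  shows "\<exists>r. filterlim r at_top sequentially \<and>
    eventually (\<lambda>n. \<forall>y. 0 \<le> y \<and> y \<le> 2 * real n \<longrightarrow>
      ((if y = 0 then 0 else inverse (h (y / real n))) \<le> u \<longleftrightarrow> y \<le> r n)) sequentially \<and>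
    (\<forall>k. eventually (\<lambda>n. \<bar>real (k n) - r n\<bar> \<le> 4) sequentially \<longrightarrow>
      (\<lambda>n. tail_intensity 2 n (k n)) \<longlonglongrightarrow> - ln u \<and> (\<lambda>n. tail_degree 2 n (k n)) \<longlonglongrightarrow> 0)"
proof -
  obtain x where x: "0 < x" "x < 2" "h x = 1 / u" using h_surj[of "1 / u"] u by auto
  have top: "filterlim (\<lambda>n. x * real n) at_top sequentially" using x by real_asymp
  have "eventually (\<lambda>n. \<forall>y. 0 \<le> y \<and> y \<le> 2 * real n \<longrightarrow>
      ((if y = 0 then 0 else inverse (h (y / real n))) \<le> u \<longleftrightarrow> y \<le> x * real n)) sequentially"
    using eventually_gt_at_top[of 0]
  proof (eventually_elim, intro allI impI)
    fix n y assume n: "0 < (n :: nat)" and y: "0 \<le> y \<and> y \<le> 2 * real n"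
    show "(if y = 0 then 0 else inverse (h (y / real n))) \<le> u \<longleftrightarrow> y \<le> x * real n"
    proof (cases "y = 0")
      case True then show ?thesis using u x by simp
    next
      case False
      define z where "z = y / real n"
      have z: "0 < z" "z \<le> 2" using False y n by (auto simp: z_def field_simps)
      have "inverse (h z) \<le> u \<longleftrightarrow> h x \<le> h z"
        using h_ge_1[OF z] u by (simp add: x(3) field_simps)
      also have "\<dots> \<longleftrightarrow> z \<le> x"
        using h_strict_antimono[of x z] h_strict_antimono[of z x] x z by (cases z x rule: linorder_cases) auto
      finally show ?thesis using False n by (simp add: z_def field_simps)
    qed
  qed
  moreover have "(\<lambda>n. tail_intensity 2 n (k n)) \<longlonglongrightarrow> - ln u \<and> (\<lambda>n. tail_degree 2 n (k n)) \<longlonglongrightarrow> 0"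
    if k: "eventually (\<lambda>n. \<bar>real (k n) - x * real n\<bar> \<le> 4) sequentially" for k
    using tail_intensity_tendsto_eq_2[OF x(1,2) k] tail_degree_tendsto_0[OF near_filterlim_at_top[OF top k]] u
    by (simp add: x(3) ln_div)
  ultimately show ?thesis using top by blast
qed

theorem theorem1p1:
  fixes \<alpha> :: real and g :: "real \<Rightarrow> real"
    and M :: "'a measure" and P :: "'a \<Rightarrow> real set" and E :: "nat \<Rightarrow> 'a \<Rightarrow> real set set"
    and N :: "'b measure" and U :: "'b \<Rightarrow> real"
    and e :: "nat \<Rightarrow> 'a \<Rightarrow> real"
  assumes alpha: "\<alpha> > 0"
    and g_meas: "g \<in> borel_measurable borel"
    and g_range: "\<And>x. g x \<in> {0..1}"
    and g_sym: "\<And>x. g x = g (- x)"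
    and g_lim: "((\<lambda>x. g x / \<bar>x\<bar> powr (- \<alpha>)) \<longlongrightarrow> 1) at_infinity"
    and M: "prob_space M"
    and P: "homogeneous_poisson_process M 1 P"
    and E: "\<And>n. soft_random_graph M g (\<lambda>\<omega>. P \<omega> \<inter> {- real n..real n}) (E n)"
    and N: "prob_space N"
    and U: "U \<in> borel_measurable N" "distr N borel U = uniform_measure lborel {0<..<1}"
    and e: "\<And>n \<omega>. e n \<omega> = longest_edge (E n \<omega>)"
  shows
    "(\<alpha> > 2 \<longrightarrow>
       weak_conv_m
         (\<lambda>n. distr M borel (\<lambda>\<omega>. if E n \<omega> = {} then 0
            else exp (2 * real n / (1 - \<alpha>) * e n \<omega> powr (1 - \<alpha>))))
         (distr N borel U)) \<and>
     (\<alpha> = 2 \<longrightarrow>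
       weak_conv_m
         (\<lambda>n. distr M borel (\<lambda>\<omega>. if E n \<omega> = {} then 0
            else inverse (h (e n \<omega> / real n))))
         (distr N borel U)) \<and>
     (1 < \<alpha> \<and> \<alpha> < 2 \<longrightarrow>
       weak_conv_m
         (\<lambda>n. distr M borel (\<lambda>\<omega>.
            exp (- ((2 * real n) powr (\<alpha> - 2) * inverse 2 * (2 - \<alpha>) powr (-2) *
                    (e n \<omega> powr (2 - \<alpha>) - (2 * real n) powr (2 - \<alpha>))\<^sup>2))))
         (distr N borel U)) \<and>
     (\<alpha> = 1 \<longrightarrow>
       weak_conv_m
         (\<lambda>n. distr M borel (\<lambda>\<omega>. if E n \<omega> = {} then 0
            else exp (- (real n * (ln (e n \<omega> / (2 * real n)))\<^sup>2))))
         (distr N borel U)) \<and>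
     (\<alpha> < 1 \<longrightarrow>
       weak_conv_m
         (\<lambda>n. distr M borel (\<lambda>\<omega>.
            exp (- ((2 * real n) powr \<alpha> * inverse 2 * (1 - \<alpha>) powr (-2) *
                    (e n \<omega> powr (1 - \<alpha>) - (2 * real n) powr (1 - \<alpha>))\<^sup>2))))
         (distr N borel U))"
proof -
  have graph: "\<And>n. poisson_random_graph M P g n (E n)"
    using M P E g_range by (simp add: poisson_random_graph_def poisson_random_graph_axioms_def)
  note conv = weak_conv_transformed_longest_edge[OF graph g_lim alpha]
  have nonempty: "E n \<omega> = {} \<longleftrightarrow> longest_edge (E n \<omega>) = 0" if "\<omega> \<in> space M" for n \<omega>
    using poisson_random_graph.longest_edge_eq_0[OF graph that] by simp
  \<comment> \<open>the cases \<open>1 < \<alpha> < 2\<close> and \<open>\<alpha> < 1\<close> in their common form\<close>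
  have squares: "weak_conv_m (\<lambda>n. distr M borel (\<lambda>\<omega>.
      exp (- ((2 * real n) powr (2 - \<alpha> - 2 * \<beta>) * inverse 2 * \<beta> powr (-2) *
        (e n \<omega> powr \<beta> - (2 * real n) powr \<beta>)\<^sup>2)))) (uniform_measure lborel {0<..<1})"
    if "\<alpha> < 2" "0 < \<beta>" for \<beta>
    by (rule conv[OF _ _ threshold_powr[OF alpha that]]) (simp_all add: e)
  show ?thesis unfolding U(2)
  proof (intro conjI impI)
    assume "\<alpha> > 2"
    show "weak_conv_m (\<lambda>n. distr M borel (\<lambda>\<omega>. if E n \<omega> = {} then 0
        else exp (2 * real n / (1 - \<alpha>) * e n \<omega> powr (1 - \<alpha>)))) (uniform_measure lborel {0<..<1})"
      by (rule conv[OF _ _ threshold_gt_2[OF \<open>\<alpha> > 2\<close>]])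
        (use \<open>\<alpha> > 2\<close> in \<open>auto simp: e nonempty intro!: mult_nonpos_nonneg divide_nonneg_neg divide_nonpos_pos divide_nonneg_nonpos\<close>)
  next
    assume \<alpha>: "\<alpha> = 2"
    have [measurable]: "h \<in> borel_measurable borel" unfolding h_def by measurable
    show "weak_conv_m (\<lambda>n. distr M borel (\<lambda>\<omega>. if E n \<omega> = {} then 0 else inverse (h (e n \<omega> / real n))))
        (uniform_measure lborel {0<..<1})"
    proof (rule conv[unfolded \<alpha>, OF _ _ threshold_eq_2])
      fix n y assume n: "0 < n" "0 \<le> y" "y \<le> 2 * real n"
      have "1 \<le> h (y / real n)" if "y \<noteq> 0" using that n by (intro h_ge_1) (auto simp: field_simps)
      then show "0 \<le> (if y = 0 then 0 else inverse (h (y / real n))) \<and> (if y = 0 then 0 else inverse (h (y / real n))) \<le> 1"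
        by (auto simp: inverse_le_1_iff)
    qed (auto simp: e nonempty)
  next
    assume \<alpha>: "1 < \<alpha> \<and> \<alpha> < 2"
    have "2 - \<alpha> - 2 * (2 - \<alpha>) = \<alpha> - 2" by simp
    then show "weak_conv_m (\<lambda>n. distr M borel (\<lambda>\<omega>.
        exp (- ((2 * real n) powr (\<alpha> - 2) * inverse 2 * (2 - \<alpha>) powr (-2) *
          (e n \<omega> powr (2 - \<alpha>) - (2 * real n) powr (2 - \<alpha>))\<^sup>2)))) (uniform_measure lborel {0<..<1})"
      using squares[of "2 - \<alpha>"] \<alpha> by simp
  next
    assume \<alpha>: "\<alpha> = 1"
    show "weak_conv_m (\<lambda>n. distr M borel (\<lambda>\<omega>. if E n \<omega> = {} then 0
        else exp (- (real n * (ln (e n \<omega> / (2 * real n)))\<^sup>2)))) (uniform_measure lborel {0<..<1})"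
      by (rule conv[unfolded \<alpha>, OF _ _ threshold_ln]) (auto simp: e nonempty)
  next
    assume \<alpha>: "\<alpha> < 1"
    have "2 - \<alpha> - 2 * (1 - \<alpha>) = \<alpha>" by simp
    then show "weak_conv_m (\<lambda>n. distr M borel (\<lambda>\<omega>.
        exp (- ((2 * real n) powr \<alpha> * inverse 2 * (1 - \<alpha>) powr (-2) *
          (e n \<omega> powr (1 - \<alpha>) - (2 * real n) powr (1 - \<alpha>))\<^sup>2)))) (uniform_measure lborel {0<..<1})"
      using squares[of "1 - \<alpha>"] \<alpha> by simp
  qed
qed

end
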